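(* Let $k\in\mathbb{N}$, $k\ge 1$, and let $\mathcal{G}_{2k}$ be the finite dimensional Grassmann algebra $\langle 1,e_1,\dots,e_{2k}\mid e_ie_j=-e_je_i\rangle$ over $F$, regarded as a superalgebra with the trivial grading. Then: (1) $c_n^{gr,z}(\mathcal{G}_{2k})=\sum_{i=0}^{k-1}\binom{n-1}{2i}$; (2) $\delta_n^{gr}(\mathcal{G}_{2k})=\binom{n}{2k}+\sum_{i=0}^{k-2}\binom{n-1}{2i+1}$; (3) $\chi_n^{gr,z}(\mathcal{G}_{2k})=\sum_{i=0}^{k-1}\chi_{(n-2i,1^{2i}),\emptyset}$; (4) $\chi_n(\Delta^{gr}(\mathcal{G}_{2k}))=\chi_{(n-2k,1^{2k}),\emptyset}+\sum_{i=0}^{k-1}\chi_{(n-2i-1,1^{2i+1}),\emptyset}$.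
   Context: $F$ is a field of characteristic zero. A superalgebra is an algebra $A=A_0\oplus A_1$ with $A_iA_j\subseteq A_{i+j\bmod 2}$ (trivial grading: $A_1=0$); $Z(A)$ is the center. $F\langle Y,Z\rangle$ is the free algebra on even variables $y_1,y_2,\dots$ and odd variables $z_1,z_2,\dots$. $\mathrm{Id}^{gr}(A)$ is the set of graded identities (polynomials vanishing under all substitutions of even variables by elements of $A_0$ and odd ones by elements of $A_1$); $C^{gr}(A)$ is the set of central graded polynomials (zero constant term, all such evaluations lie in $Z(A)$). $P_n^{gr}$ is the span of monomials $w_{\sigma(1)}\cdots w_{\sigma(n)}$, $\sigma\in S_n$, $w_i\in\{y_i,z_i\}$; $c_n^{gr,z}(A)=\dim P_n^{gr}/(P_n^{gr}\cap C^{gr}(A))$, $\delta_n^{gr}(A)=\dim(P_n^{gr}\cap C^{gr}(A))/(P_n^{gr}\cap\mathrm{Id}^{gr}(A))$. $\mathbb{Z}_2\wr S_n$ acts on $P_n^{gr}$ by $(a_1,\dots,a_n;\sigma)y_i=y_{\sigma(i)}$, $(a_1,\dots,a_n;\sigma)z_i=a_{\sigma(i)}z_{\sigma(i)}$ ($a_j=\pm1$); $\chi_n^{gr,z}(A)$ and $\chi_n(\Delta^{gr}(A))$ are the characters of the modules $P_n^{gr}/(P_n^{gr}\cap C^{gr}(A))$ and $(P_n^{gr}\cap C^{gr}(A))/(P_n^{gr}\cap\mathrm{Id}^{gr}(A))$. $\chi_{\lambda,\mu}$ is the irreducible $\mathbb{Z}_2\wr S_n$-character indexed by $\lambda\vdash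 n-r$ (even variables), $\mu\vdash r$ (odd variables); $\emptyset$ is the empty partition and $1^j$ denotes $j$ parts equal to $1$. *)

theory Defs
  imports Complex_Main "HOL-Library.Function_Algebras" "HOL-Combinatorics.Permutations"
begin

definition fsc :: "'a::field \<Rightarrow> ('b \<Rightarrow> 'a) \<Rightarrow> ('b \<Rightarrow> 'a)" where
  "fsc c f = (\<lambda>x. c * f x)"

definition fdim :: "('b \<Rightarrow> 'a::field) set \<Rightarrow> nat" where
  "fdim U = vector_space.dim fsc U"

definition ftrace :: "('b \<Rightarrow> 'a::field) set \<Rightarrow> (('b \<Rightarrow> 'a) \<Rightarrow> ('b \<Rightarrow> 'a)) \<Rightarrow> 'a" where
  "ftrace U T = (let B = (SOME B. B \<subseteq> U \<and> \<not> module.dependent fsc B \<and> module.span fsc B = U)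
     in \<Sum>b\<in>B. module.representation fsc B (T b) b)"

record ('b, 'a) superalg =
  sa0 :: "('b \<Rightarrow> 'a) set"
  sa1 :: "('b \<Rightarrow> 'a) set"
  samul :: "('b \<Rightarrow> 'a) \<Rightarrow> ('b \<Rightarrow> 'a) \<Rightarrow> ('b \<Rightarrow> 'a)"
  saone :: "'b \<Rightarrow> 'a"

definition sa_carrier :: "('b, 'a::ab_group_add) superalg \<Rightarrow> ('b \<Rightarrow> 'a) set" where
  "sa_carrier A = {x + y | x y. x \<in> sa0 A \<and> y \<in> sa1 A}"

definition sa_center :: "('b, 'a::ab_group_add) superalg \<Rightarrow> ('b \<Rightarrow> 'a) set" where
  "sa_center A = {x \<in> sa_carrier A. \<forall>y \<in> sa_carrier A. samul A x y = samul A y x}"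

text \<open>An element is the coefficient function S \<mapsto> coefficient of e_S, S \<subseteq> {1..2k},
  where e_S is the ordered product of the e_i, i \<in> S.\<close>
definition grass_sign :: "nat set \<Rightarrow> nat set \<Rightarrow> 'a::comm_ring_1" where
  "grass_sign T U = (-1) ^ card {(t, u). t \<in> T \<and> u \<in> U \<and> u < t}"

definition grass_mult :: "(nat set \<Rightarrow> 'a::comm_ring_1) \<Rightarrow> (nat set \<Rightarrow> 'a) \<Rightarrow> (nat set \<Rightarrow> 'a)" where
  "grass_mult g h = (\<lambda>S. \<Sum>T\<in>Pow S. grass_sign T (S - T) * g T * h (S - T))"

definition grass_one :: "nat set \<Rightarrow> 'a::comm_ring_1" where
  "grass_one = (\<lambda>S. if S = {} then 1 else 0)"

definition grass_carrier :: "nat \<Rightarrow> (nat set \<Rightarrow> 'a::comm_ring_1) set" where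
  "grass_carrier k = {g. \<forall>S. g S \<noteq> 0 \<longrightarrow> S \<subseteq> {1..2*k}}"

definition grassmann_trivial :: "nat \<Rightarrow> (nat set, 'a::comm_ring_1) superalg" where
  "grassmann_trivial k = \<lparr>sa0 = grass_carrier k, sa1 = {0}, samul = grass_mult, saone = grass_one\<rparr>"

text \<open>The monomial w_{\<sigma>(1)} ... w_{\<sigma>(n)} is encoded by (\<sigma>, Od) where Od is the set of
  indices i with w_i = z_i (odd); the others are w_i = y_i.\<close>
definition gr_monos :: "nat \<Rightarrow> ((nat \<Rightarrow> nat) \<times> nat set) set" where
  "gr_monos n = {(\<sigma>, Od). \<sigma> permutes {1..n} \<and> Od \<subseteq> {1..n}}"

definition Pgr :: "nat \<Rightarrow> (((nat \<Rightarrow> nat) \<times> nat set) \<Rightarrow> 'a::zero) set" where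
  "Pgr n = {f. \<forall>m. m \<notin> gr_monos n \<longrightarrow> f m = 0}"

definition mono_eval :: "('b, 'a) superalg \<Rightarrow> nat \<Rightarrow> ((nat \<Rightarrow> nat) \<times> nat set)
    \<Rightarrow> (nat \<Rightarrow> 'b \<Rightarrow> 'a) \<Rightarrow> (nat \<Rightarrow> 'b \<Rightarrow> 'a) \<Rightarrow> ('b \<Rightarrow> 'a)" where
  "mono_eval A n m u v = (case m of (\<sigma>, Od) \<Rightarrow>
     foldr (samul A) (map (\<lambda>p. if \<sigma> p \<in> Od then v (\<sigma> p) else u (\<sigma> p)) [1..<Suc n]) (saone A))"

definition poly_eval :: "('b, 'a::comm_ring_1) superalg \<Rightarrow> nat \<Rightarrow> (((nat \<Rightarrow> nat) \<times> nat set) \<Rightarrow> 'a)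
    \<Rightarrow> (nat \<Rightarrow> 'b \<Rightarrow> 'a) \<Rightarrow> (nat \<Rightarrow> 'b \<Rightarrow> 'a) \<Rightarrow> ('b \<Rightarrow> 'a)" where
  "poly_eval A n f u v = (\<lambda>x. \<Sum>m\<in>gr_monos n. f m * mono_eval A n m u v x)"

text \<open>P_n^gr \<inter> C^gr(A) (multilinear of degree n \<ge> 1, so constant term is zero).\<close>
definition CPgr :: "('b, 'a::comm_ring_1) superalg \<Rightarrow> nat \<Rightarrow> (((nat \<Rightarrow> nat) \<times> nat set) \<Rightarrow> 'a) set" where
  "CPgr A n = {f \<in> Pgr n. \<forall>u v. (\<forall>i. u i \<in> sa0 A) \<longrightarrow> (\<forall>i. v i \<in> sa1 A)
                  \<longrightarrow> poly_eval A n f u v \<in> sa_center A}"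

definition IdPgr :: "('b, 'a::comm_ring_1) superalg \<Rightarrow> nat \<Rightarrow> (((nat \<Rightarrow> nat) \<times> nat set) \<Rightarrow> 'a) set" where
  "IdPgr A n = {f \<in> Pgr n. \<forall>u v. (\<forall>i. u i \<in> sa0 A) \<longrightarrow> (\<forall>i. v i \<in> sa1 A)
                  \<longrightarrow> poly_eval A n f u v = 0}"

text \<open>Dimensions of the quotients, as differences of dimensions of finite dimensional spaces.\<close>
definition cgrz :: "('b, 'a::field) superalg \<Rightarrow> nat \<Rightarrow> nat" where
  "cgrz A n = fdim (Pgr n :: (((nat \<Rightarrow> nat) \<times> nat set) \<Rightarrow> 'a) set) - fdim (CPgr A n)"

definition deltagr :: "('b, 'a::field) superalg \<Rightarrow> nat \<Rightarrow> nat" where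
  "deltagr A n = fdim (CPgr A n) - fdim (IdPgr A n)"

text \<open>An element (a_1,...,a_n;\<sigma>) is encoded by (N, \<sigma>) with N = {j. a_j = -1}.\<close>
definition wreath :: "nat \<Rightarrow> (nat set \<times> (nat \<Rightarrow> nat)) set" where
  "wreath n = {(N, \<sigma>). N \<subseteq> {1..n} \<and> \<sigma> permutes {1..n}}"

text \<open>(N;\<sigma>) sends the monomial (\<tau>, Od) to (-1)^|\<sigma>(Od) \<inter> N| times the monomial (\<sigma> \<circ> \<tau>, \<sigma>(Od)).\<close>
definition wr_act :: "nat \<Rightarrow> nat set \<times> (nat \<Rightarrow> nat) \<Rightarrow> (((nat \<Rightarrow> nat) \<times> nat set) \<Rightarrow> 'a::comm_ring_1)
    \<Rightarrow> (((nat \<Rightarrow> nat) \<times> nat set) \<Rightarrow> 'a)" where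
  "wr_act n g f = (case g of (N, \<sigma>) \<Rightarrow> (\<lambda>(\<tau>, Od).
      if (\<tau>, Od) \<in> gr_monos n then (-1) ^ card (Od \<inter> N) * f (inv \<sigma> \<circ> \<tau>, inv \<sigma> ` Od) else 0))"

text \<open>Characters of the quotient modules (character of P/U = character of P - character of U).\<close>
definition chi_grz :: "('b, 'a::field) superalg \<Rightarrow> nat \<Rightarrow> nat set \<times> (nat \<Rightarrow> nat) \<Rightarrow> 'a" where
  "chi_grz A n g = ftrace (Pgr n) (wr_act n g) - ftrace (CPgr A n) (wr_act n g)"

definition chi_Delta :: "('b, 'a::field) superalg \<Rightarrow> nat \<Rightarrow> nat set \<times> (nat \<Rightarrow> nat) \<Rightarrow> 'a" where
  "chi_Delta A n g = ftrace (CPgr A n) (wr_act n g) - ftrace (IdPgr A n) (wr_act n g)"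

definition is_partition :: "nat \<Rightarrow> nat list \<Rightarrow> bool" where
  "is_partition n la = (sorted_wrt (\<ge>) la \<and> (\<forall>x\<in>set la. 0 < x) \<and> sum_list la = n)"

text \<open>Row-reading canonical tableau: cell (r,c) (0-based) contains the entry below.\<close>
definition tab :: "nat list \<Rightarrow> nat \<times> nat \<Rightarrow> nat" where
  "tab la rc = sum_list (take (fst rc) la) + snd rc + 1"

definition cells :: "nat list \<Rightarrow> (nat \<times> nat) set" where
  "cells la = {(r, c). r < length la \<and> c < la ! r}"

definition row_group :: "nat list \<Rightarrow> nat \<Rightarrow> (nat \<Rightarrow> nat) set" where
  "row_group la n = {p. p permutes {1..n} \<and>
     (\<forall>(r, c)\<in>cells la. \<exists>c'. (r, c') \<in> cells la \<and> p (tab la (r, c)) = tab la (r, c'))}"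

definition col_group :: "nat list \<Rightarrow> nat \<Rightarrow> (nat \<Rightarrow> nat) set" where
  "col_group la n = {q. q permutes {1..n} \<and>
     (\<forall>(r, c)\<in>cells la. \<exists>r'. (r', c) \<in> cells la \<and> q (tab la (r, c)) = tab la (r', c))}"

definition group_alg :: "nat \<Rightarrow> ((nat \<Rightarrow> nat) \<Rightarrow> 'a::zero) set" where
  "group_alg n = {x. \<forall>\<pi>. x \<pi> \<noteq> 0 \<longrightarrow> \<pi> permutes {1..n}}"

definition ga_mult :: "nat \<Rightarrow> ((nat \<Rightarrow> nat) \<Rightarrow> 'a::comm_ring_1) \<Rightarrow> ((nat \<Rightarrow> nat) \<Rightarrow> 'a) \<Rightarrow> ((nat \<Rightarrow> nat) \<Rightarrow> 'a)" where
  "ga_mult n x y = (\<lambda>\<pi>. \<Sum>\<rho>\<in>{\<rho>. \<rho> permutes {1..n}}. x \<rho> * y (inv \<rho> \<circ> \<pi>))"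

definition young_sym :: "nat list \<Rightarrow> nat \<Rightarrow> ((nat \<Rightarrow> nat) \<Rightarrow> 'a::comm_ring_1)" where
  "young_sym la n = (\<lambda>\<pi>. \<Sum>p\<in>row_group la n. \<Sum>q\<in>col_group la n.
       if p \<circ> q = \<pi> then of_int (sign q) else 0)"

definition specht_module :: "nat list \<Rightarrow> nat \<Rightarrow> ((nat \<Rightarrow> nat) \<Rightarrow> 'a::comm_ring_1) set" where
  "specht_module la n = {ga_mult n x (young_sym la n) | x. x \<in> group_alg n}"

definition specht_char :: "nat \<Rightarrow> nat list \<Rightarrow> (nat \<Rightarrow> nat) \<Rightarrow> 'a::field" where
  "specht_char n la \<sigma> = (if is_partition n la
     then ftrace (specht_module la n) (\<lambda>x. \<lambda>\<pi>. x (inv \<sigma> \<circ> \<pi>)) else 0)"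

text \<open>chi_{(lambda, \<emptyset>)}: the irreducible character of Z_2 wr S_n with all variables even,
  i.e. the inflation of chi_lambda (Z_2^n acts trivially).\<close>
definition wr_char_even :: "nat \<Rightarrow> nat list \<Rightarrow> nat set \<times> (nat \<Rightarrow> nat) \<Rightarrow> 'a::field" where
  "wr_char_even n la g = specht_char n la (snd g)"

definition hook :: "nat \<Rightarrow> nat \<Rightarrow> nat list" where
  "hook n j = (n - j) # replicate j 1"

end

theory Submission
  imports Defs "HOL-Library.FuncSet"
begin

text \<open>Since the center of the Grassmann algebra is its even part, a multilinear \<open>f\<close> is an identity
  (a central polynomial) iff the signed coefficient sums \<open>L\<^sub>I(f) = \<Sum>\<^sub>\<sigma> \<plusminus>f\<^sub>\<sigma>\<close> vanish for all
  \<open>|I| \<le> 2k\<close> (all odd \<open>|I| < 2k\<close>), where \<open>I\<close> is the set of variables receiving odd values. Collecting the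
  \<open>L\<^sub>I\<close> with \<open>|I| = j\<close> gives an equivariant map into the exterior power \<open>\<Lambda>\<^sup>j F\<^sup>n\<close> of the permutation
  module. In even degrees these maps are jointly onto, and in degree \<open>2i + 1\<close> the map is the one in
  degree \<open>2i\<close> followed by multiplication by \<open>s = e\<^sub>1 + \<dots> + e\<^sub>n\<close>. Multiplication by \<open>s\<close> is exact, and
  \<open>s \<and> \<Lambda>\<^sup>j F\<^sup>n\<close> is isomorphic to the Specht module of the hook \<open>(n - j, 1\<^sup>j)\<close>. Dimensions are traces of
  the identity.\<close>

section \<open>Traces on finite dimensional function spaces\<close>

text \<open>As A_1 = 0, every monomial with an odd variable evaluates to 0, so all happens on
  polynomials in y_1, ..., y_n. The obstacle is joint surjectivity in the even degrees. The image is
  stable under S_n and contains the sum of all basis vectors e_I, the image of y_1 ... y_n. For the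
  transposition \<tau> of 2m+1 and 2m+2 the operator (1 - \<tau>)/2 keeps, among sums of this kind,
  just the e_I with both indices in I. Indices are thus forced into I in pairs, which is why the
  argument is made in even degrees.

  Write H_j for the character of s \<and> \<Lambda>^j. Exactness gives H_(j-1) + H_j as the
  character of \<Lambda>^j for j \<ge> 1, and H_0 for j = 0. Modulo central polynomials one finds
  the sum of the H_(2i) with i < k; modulo identities the sum of the \<Lambda>^(2i) with i \<le> k.
  The difference is H_(2k) plus all H_(2i+1) with i < k.\<close>

interpretation fsc: vector_space "fsc :: 'a::field \<Rightarrow> ('b \<Rightarrow> 'a) \<Rightarrow> 'b \<Rightarrow> 'a"
  by unfold_locales (auto simp: fsc_def algebra_simps fun_eq_iff)

interpretation fsc: vector_space_pair
  "fsc :: 'a::field \<Rightarrow> ('b \<Rightarrow> 'a) \<Rightarrow> 'b \<Rightarrow> 'a" "fsc :: 'a \<Rightarrow> ('c \<Rightarrow> 'a) \<Rightarrow> 'c \<Rightarrow> 'a"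
  ..

abbreviation flinear :: "(('b \<Rightarrow> 'a::field) \<Rightarrow> ('c \<Rightarrow> 'a)) \<Rightarrow> bool" where
  "flinear \<equiv> Vector_Spaces.linear fsc fsc"

lemma fsc_apply [simp]: "fsc c f x = c * f x"
  by (simp add: fsc_def)

lemma sum_fun_apply: "(\<Sum>i\<in>I. f i) x = (\<Sum>i\<in>I. f i x)"
  by (induction I rule: infinite_finite_induct) auto

lemma flinearI:
  fixes T :: "('b \<Rightarrow> 'a::field) \<Rightarrow> ('c \<Rightarrow> 'a)"
  assumes "\<And>x y. T (x + y) = T x + T y" "\<And>c x. T (fsc c x) = fsc c (T x)"
  shows "flinear T"
  using assms by (simp add: Vector_Spaces.linear_iff fsc.vector_space_axioms)

text \<open>Inclusion in \<open>fsupp M\<close> with \<open>M\<close> finite is the form in which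
  finite dimension enters the trace lemmas.\<close>

definition fsupp :: "'b set \<Rightarrow> ('b \<Rightarrow> 'a::zero) set" where
  "fsupp M = {f. \<forall>x. x \<notin> M \<longrightarrow> f x = 0}"

definition fsingle :: "'b \<Rightarrow> 'b \<Rightarrow> 'a::zero_neq_one" where
  "fsingle a = (\<lambda>x. if x = a then 1 else 0)"

lemma subspace_fsupp: "fsc.subspace (fsupp M)"
  by (auto simp: fsc.subspace_def fsupp_def)

lemma fsupp_eq_sum:
  fixes f :: "'b \<Rightarrow> 'a::field"
  assumes "finite M" "f \<in> fsupp M"
  shows "f = (\<Sum>a\<in>M. fsc (f a) (fsingle a))"
proof
  fix x
  have "(\<Sum>a\<in>M. fsc (f a) (fsingle a)) x = (\<Sum>a\<in>M. if a = x then f a else 0)"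
    by (auto simp: sum_fun_apply fsingle_def intro!: sum.cong)
  then show "f x = (\<Sum>a\<in>M. fsc (f a) (fsingle a)) x"
    using assms by (auto simp: fsupp_def)
qed

lemma fsupp_subset_subspaceI:
  fixes V :: "('b \<Rightarrow> 'a::field) set"
  assumes "finite M" "fsc.subspace V" "\<And>a. a \<in> M \<Longrightarrow> fsingle a \<in> V"
  shows "fsupp M \<subseteq> V"
proof
  fix f :: "'b \<Rightarrow> 'a" assume "f \<in> fsupp M"
  then have "f = (\<Sum>a\<in>M. fsc (f a) (fsingle a))" using assms(1) by (rule fsupp_eq_sum[rotated])
  also have "\<dots> \<in> V" using assms by (intro fsc.subspace_sum fsc.subspace_scale) auto
  finally show "f \<in> V" .
qed

lemma inj_fsingle: "inj (fsingle :: 'b \<Rightarrow> 'b \<Rightarrow> 'a::zero_neq_one)"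
proof (rule injI)
  fix x y :: 'b assume "(fsingle x :: 'b \<Rightarrow> 'a) = fsingle y"
  then have "(fsingle x :: 'b \<Rightarrow> 'a) x = fsingle y x" by simp
  then show "x = y" by (auto simp: fsingle_def split: if_splits)
qed

lemma span_fsingle:
  assumes "finite M"
  shows "fsc.span (fsingle ` M) = (fsupp M :: ('b \<Rightarrow> 'a::field) set)"
proof
  show "fsc.span (fsingle ` M) \<subseteq> (fsupp M :: ('b \<Rightarrow> 'a::field) set)"
    by (rule fsc.span_minimal[OF _ subspace_fsupp]) (auto simp: fsupp_def fsingle_def)
  show "(fsupp M :: ('b \<Rightarrow> 'a::field) set) \<subseteq> fsc.span (fsingle ` M)"
    using assms by (intro fsupp_subset_subspaceI fsc.subspace_span) (auto intro: fsc.span_base)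
qed

lemma independent_fsingle:
  assumes "finite M"
  shows "fsc.independent (fsingle ` M :: ('b \<Rightarrow> 'a::field) set)"
proof
  assume "fsc.dependent (fsingle ` M :: ('b \<Rightarrow> 'a) set)"
  then obtain a :: 'b where a: "a \<in> M"
    "(fsingle a :: 'b \<Rightarrow> 'a) \<in> fsc.span (fsingle ` M - {fsingle a})"
    unfolding fsc.dependent_def by auto
  have "(fsingle ` M - {fsingle a} :: ('b \<Rightarrow> 'a) set) = fsingle ` (M - {a})"
    by (auto dest: injD[OF inj_fsingle])
  then have "(fsingle a :: 'b \<Rightarrow> 'a) \<in> fsupp (M - {a})"
    using a(2) span_fsingle[of "M - {a}", where 'a='a] assms by simp
  then show False by (auto simp: fsupp_def fsingle_def)
qed

lemma finite_independent_fsupp: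
  fixes B :: "('b \<Rightarrow> 'a::field) set"
  assumes "finite M" "fsc.independent B" "B \<subseteq> fsupp M"
  shows "finite B"
  using fsc.independent_span_bound[of "fsingle ` M :: ('b \<Rightarrow> 'a) set" B] assms
    span_fsingle[OF assms(1), where 'a='a] by auto

text \<open>This is tr(PQ) = tr(QP), with P the change of basis and Q the coordinates in
  \<open>B\<close> of the images under \<open>T\<close> of \<open>B'\<close>: both diagonal sums
  unfold to the same double sum over \<open>B\<close> and \<open>B'\<close>.\<close>

lemma basis_trace_unique:
  fixes B B' :: "('b \<Rightarrow> 'a::field) set"
  assumes B: "finite B" "fsc.independent B" and B': "finite B'" "fsc.independent B'"
    and eq: "fsc.span B = fsc.span B'"
    and T: "flinear T" "\<And>x. x \<in> fsc.span B \<Longrightarrow> T x \<in> fsc.span B"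
  shows "(\<Sum>b\<in>B. fsc.representation B (T b) b) = (\<Sum>b\<in>B'. fsc.representation B' (T b) b)"
proof -
  interpret T: Vector_Spaces.linear fsc fsc T by fact
  note [simp] = fsc.representation_sum fsc.representation_scale fsc.span_scale B B'
  have TB: "T b \<in> fsc.span B" if "b \<in> B \<union> B'" for b
    using that T(2) eq fsc.span_base by blast
  have 1: "fsc.representation B (T b) b =
      (\<Sum>c\<in>B'. fsc.representation B' b c * fsc.representation B (T c) b)" if "b \<in> B" for b
  proof -
    have b: "(\<Sum>c\<in>B'. fsc (fsc.representation B' b c) c) = b"
      using that eq B' by (intro fsc.sum_representation_eq) (auto intro: fsc.span_base)
    have "T b = T (\<Sum>c\<in>B'. fsc (fsc.representation B' b c) c)"
      using b by simp
    also have "\<dots> = (\<Sum>c\<in>B'. fsc (fsc.representation B' b c) (T c))"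
      by (simp only: T.sum T.scale)
    finally show ?thesis by (simp add: TB)
  qed
  have 2: "fsc.representation B' (T c) c =
      (\<Sum>b\<in>B. fsc.representation B (T c) b * fsc.representation B' b c)" if "c \<in> B'" for c
  proof -
    have *: "b \<in> fsc.span B'" if "b \<in> B" for b using that eq fsc.span_base by blast
    have "(\<Sum>b\<in>B. fsc (fsc.representation B (T c) b) b) = T c"
      using that TB by (intro fsc.sum_representation_eq) auto
    then have "fsc.representation B' (T c) c =
        fsc.representation B' (\<Sum>b\<in>B. fsc (fsc.representation B (T c) b) b) c"
      by simp
    then show ?thesis by (simp add: *)
  qed
  have "(\<Sum>b\<in>B. fsc.representation B (T b) b) =
      (\<Sum>b\<in>B. \<Sum>c\<in>B'. fsc.representation B' b c * fsc.representation B (T c) b)"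
    using 1 by simp
  also have "\<dots> = (\<Sum>c\<in>B'. fsc.representation B' (T c) c)"
    using 2 by (subst sum.swap) (simp add: mult.commute)
  finally show ?thesis .
qed

text \<open>The basis chosen inside \<open>ftrace\<close> depends on \<open>U\<close> alone, so a
  single \<open>B\<close> serves all operators \<open>T\<close> at once.\<close>

lemma ftrace_some_basis:
  fixes U :: "('b \<Rightarrow> 'a::field) set"
  assumes "fsc.subspace U"
  obtains B where "B \<subseteq> U" "fsc.independent B" "fsc.span B = U"
    "\<And>T. ftrace U T = (\<Sum>b\<in>B. fsc.representation B (T b) b)"
proof -
  let ?P = "\<lambda>B. B \<subseteq> U \<and> fsc.independent B \<and> fsc.span B = U"
  define B where "B = (SOME B. ?P B)"
  obtain B0 where "B0 \<subseteq> U" "fsc.independent B0" "U \<subseteq> fsc.span B0"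
    using fsc.maximal_independent_subset[of U] by auto
  then have "?P B0" using fsc.span_minimal[OF _ assms, of B0] by auto
  then have "?P B" unfolding B_def by (rule someI)
  then show thesis using that[of B] unfolding ftrace_def B_def[symmetric] Let_def by auto
qed

lemma ftrace_eq:
  fixes B :: "('b \<Rightarrow> 'a::field) set"
  assumes "finite B" "fsc.independent B" "fsc.span B = U"
    and T: "flinear T" "\<And>x. x \<in> U \<Longrightarrow> T x \<in> U"
  shows "ftrace U T = (\<Sum>b\<in>B. fsc.representation B (T b) b)"
proof -
  have "fsc.subspace U" using assms(3) fsc.subspace_span by blast
  then obtain B' where B': "B' \<subseteq> U" "fsc.independent B'" "fsc.span B' = U"
    "\<And>T. ftrace U T = (\<Sum>b\<in>B'. fsc.representation B' (T b) b)"
    by (rule ftrace_some_basis) blast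
  moreover have "finite B'"
    using fsc.independent_span_bound[of B B'] assms B' by auto
  ultimately show ?thesis using assms basis_trace_unique[of B' B T] by auto
qed

text \<open>Each basis vector contributes 1. For an infinite basis both sides are 0, the default of
  \<open>card\<close> and of \<open>sum\<close>.\<close>

lemma of_nat_fdim:
  assumes "fsc.subspace U"
  shows "of_nat (fdim U) = ftrace U (\<lambda>x. x)"
proof -
  obtain B where B: "B \<subseteq> U" "fsc.independent B" "fsc.span B = U"
    "\<And>T. ftrace U T = (\<Sum>b\<in>B. fsc.representation B (T b) b)"
    using assms by (rule ftrace_some_basis) blast
  have "fdim U = card B"
    using fsc.dim_eq_card[of B U] B by (simp add: fdim_def fsc.span_eq_iff[THEN iffD2, OF assms])
  then show ?thesis using B by (simp add: fsc.representation_basis)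
qed

lemma ftrace_fsupp_id:
  assumes "finite M"
  shows "ftrace (fsupp M :: ('b \<Rightarrow> 'a::field) set) (\<lambda>x. x) = of_nat (card M)"
proof -
  have "ftrace (fsupp M :: ('b \<Rightarrow> 'a) set) (\<lambda>x. x) =
      (\<Sum>b\<in>fsingle ` M. fsc.representation (fsingle ` M) b b)"
    using assms by (intro ftrace_eq)
      (auto simp: independent_fsingle span_fsingle fsc.linear_ident)
  also have "\<dots> = of_nat (card (fsingle ` M :: ('b \<Rightarrow> 'a) set))"
    using assms by (simp add: fsc.representation_basis independent_fsingle)
  also have "card (fsingle ` M :: ('b \<Rightarrow> 'a) set) = card M"
    by (intro card_image inj_on_subset[OF inj_fsingle]) auto
  finally show ?thesis .
qed

lemma ftrace_zero: "ftrace {0 :: 'b \<Rightarrow> 'a::field} T = 0"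
proof -
  have "fsc.subspace {0 :: 'b \<Rightarrow> 'a}" by (simp add: fsc.subspace_single_0)
  then obtain B where "B \<subseteq> {0}" "fsc.independent B"
    and tr: "\<And>T. ftrace {0 :: 'b \<Rightarrow> 'a} T = (\<Sum>b\<in>B. fsc.representation B (T b) b)"
    by (rule ftrace_some_basis) blast
  then have "B = {}" using fsc.dependent_zero by auto
  then show ?thesis by (simp add: tr)
qed

lemma ftrace_cong:
  assumes "\<And>x. x \<in> U \<Longrightarrow> T x = T' x" "fsc.subspace U"
  shows "ftrace U T = ftrace U T'"
proof -
  obtain B where B: "B \<subseteq> U" "\<And>T. ftrace U T = (\<Sum>b\<in>B. fsc.representation B (T b) b)"
    using assms(2) by (rule ftrace_some_basis) blast
  then show ?thesis using assms(1) by (auto intro!: sum.cong)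
qed

text \<open>In a basis of \<open>U\<close> that extends a basis of the kernel, \<open>T\<close> is
  block triangular; the added vectors map to a basis of the image, on which \<open>T'\<close> has
  the matrix of the quotient block. With \<open>T\<close> and \<open>T'\<close> the actions of a
  group element, this computes characters of quotient modules.\<close>

lemma ftrace_rank_nullity:
  fixes U :: "('b \<Rightarrow> 'a::field) set" and \<Phi> :: "('b \<Rightarrow> 'a) \<Rightarrow> ('c \<Rightarrow> 'a)"
  assumes U: "fsc.subspace U" "U \<subseteq> fsupp M" "finite M"
    and lin: "flinear \<Phi>" "flinear T" "flinear T'"
    and TU: "\<And>x. x \<in> U \<Longrightarrow> T x \<in> U"
    and comm: "\<And>x. x \<in> U \<Longrightarrow> \<Phi> (T x) = T' (\<Phi> x)"
  shows "ftrace U T = ftrace {x \<in> U. \<Phi> x = 0} T + ftrace (\<Phi> ` U) T'"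
proof -
  interpret \<Phi>: Vector_Spaces.linear fsc fsc \<Phi> by fact
  interpret T': Vector_Spaces.linear fsc fsc T' by fact
  define K where "K = {x \<in> U. \<Phi> x = 0}"
  have K: "fsc.subspace K"
    using U(1) by (auto simp: K_def fsc.subspace_def \<Phi>.add \<Phi>.scale \<Phi>.zero)
  obtain A where A: "A \<subseteq> K" "fsc.independent A" "fsc.span A = K"
    using fsc.maximal_independent_subset[of K] fsc.span_minimal[OF _ K] by (metis subset_antisym)
  obtain B where B: "A \<subseteq> B" "B \<subseteq> U" "fsc.independent B" "U \<subseteq> fsc.span B"
    using fsc.maximal_independent_subset_extend[of A U] A by (auto simp: K_def)
  have spanB: "fsc.span B = U" using B fsc.span_minimal[OF _ U(1)] by blast
  have fin: "finite B" using B U by (meson finite_independent_fsupp subset_trans)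
  define C where "C = B - A"
  have C: "finite C" "fsc.independent C" "C \<subseteq> B"
    using fin B fsc.independent_mono[of B C] by (auto simp: C_def)
  have finA: "finite A" using fin B finite_subset by blast
  have \<Phi>A: "\<Phi> a = 0" if "a \<in> A" for a using that A by (auto simp: K_def)
  have inj: "inj_on \<Phi> (fsc.span C)"
  proof (subst \<Phi>.inj_on_iff_eq_0[OF fsc.subspace_span], intro ballI impI)
    fix x assume x: "x \<in> fsc.span C" "\<Phi> x = 0"
    then have "x \<in> U" using fsc.span_mono[OF C(3)] spanB by auto
    then have xA: "x \<in> fsc.span A" using x A by (auto simp: K_def)
    \<comment> \<open>The vector lies in the spans of the disjoint parts \<open>A\<close> and
      \<open>C\<close> of one basis, so no coordinate survives.\<close>
    have "fsc.representation C x b = 0" for b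
    proof -
      have "fsc.representation A x = fsc.representation B x"
        using fsc.representation_extend[OF B(3) xA B(1)] by simp
      also have "\<dots> = fsc.representation C x"
        using fsc.representation_extend[OF B(3) x(1) C(3)] by simp
      finally show ?thesis
        using fsc.representation_ne_zero[of A x b] fsc.representation_ne_zero[of C x b]
        by (auto simp: C_def)
    qed
    then show "x = 0"
      using fsc.sum_representation_eq[OF C(2) x(1) C(1) subset_refl] by simp
  qed
  have injC: "inj_on \<Phi> C" using inj fsc.span_superset by (rule inj_on_subset)
  have ind: "fsc.independent (\<Phi> ` C)"
    using fsc.linear_independent_injective_image[OF lin(1) C(2) inj] .
  have sum\<Phi>: "\<Phi> v = (\<Sum>c\<in>C. fsc (fsc.representation B v c) (\<Phi> c))" if "v \<in> U" for v
  proof -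
    have "\<Phi> v = \<Phi> (\<Sum>b\<in>B. fsc (fsc.representation B v b) b)"
      using fsc.sum_representation_eq[OF B(3) _ fin subset_refl, of v] that spanB by simp
    also have "\<dots> = (\<Sum>b\<in>B. fsc (fsc.representation B v b) (\<Phi> b))"
      by (simp only: \<Phi>.sum \<Phi>.scale)
    also have "\<dots> = (\<Sum>b\<in>C. fsc (fsc.representation B v b) (\<Phi> b))"
      using fin \<Phi>A by (intro sum.mono_neutral_right) (auto simp: C_def)
    finally show ?thesis .
  qed
  have span\<Phi>: "fsc.span (\<Phi> ` C) = \<Phi> ` U"
  proof
    show "fsc.span (\<Phi> ` C) \<subseteq> \<Phi> ` U"
      using C B U by (intro fsc.span_minimal \<Phi>.subspace_image) auto
    show "\<Phi> ` U \<subseteq> fsc.span (\<Phi> ` C)"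
      using sum\<Phi> by (auto intro!: fsc.span_sum fsc.span_scale intro: fsc.span_base)
  qed
  have rep: "fsc.representation (\<Phi> ` C) (\<Phi> v) (\<Phi> c) = fsc.representation B v c"
    if "v \<in> U" "c \<in> C" for v c
  proof -
    have *: "\<Phi> c \<in> fsc.span (\<Phi> ` C)" if "c \<in> C" for c using that fsc.span_base by blast
    have "fsc.representation (\<Phi> ` C) (\<Phi> v) (\<Phi> c) =
        (\<Sum>b\<in>C. fsc.representation B v b * fsc.representation (\<Phi> ` C) (\<Phi> b) (\<Phi> c))"
      using that(1) * by (simp add: sum\<Phi>[of v] ind fsc.representation_sum fsc.representation_scale fsc.span_scale)
    also have "\<dots> = (\<Sum>b\<in>C. if b = c then fsc.representation B v b else 0)"
      using that(2) injC by (intro sum.cong) (auto simp: fsc.representation_basis[OF ind] inj_on_eq_iff)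
    also have "\<dots> = fsc.representation B v c" using that C by simp
    finally show ?thesis .
  qed
  have TK: "T x \<in> K" if "x \<in> K" for x
    using that TU comm by (auto simp: K_def T'.zero)
  have "ftrace (\<Phi> ` U) T' = (\<Sum>b\<in>\<Phi> ` C. fsc.representation (\<Phi> ` C) (T' b) b)"
    using C ind span\<Phi> lin TU comm by (intro ftrace_eq) (auto simp flip: comm)
  also have "\<dots> = (\<Sum>c\<in>C. fsc.representation (\<Phi> ` C) (T' (\<Phi> c)) (\<Phi> c))"
    using injC by (simp add: sum.reindex)
  also have "\<dots> = (\<Sum>c\<in>C. fsc.representation B (T c) c)"
  proof (rule sum.cong[OF refl])
    fix c assume c: "c \<in> C"
    then have "c \<in> U" using C B by auto
    then show "fsc.representation (\<Phi> ` C) (T' (\<Phi> c)) (\<Phi> c) = fsc.representation B (T c) c"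
      using rep[OF TU c] comm by simp
  qed
  finally have 1: "ftrace (\<Phi> ` U) T' = (\<Sum>c\<in>C. fsc.representation B (T c) c)" .
  have "ftrace K T = (\<Sum>b\<in>A. fsc.representation A (T b) b)"
    using A finA TK lin by (intro ftrace_eq) auto
  also have "\<dots> = (\<Sum>b\<in>A. fsc.representation B (T b) b)"
    using TK A B by (intro sum.cong refl fsc.representation_extend[symmetric, THEN fun_cong]) auto
  finally have 2: "ftrace K T = (\<Sum>b\<in>A. fsc.representation B (T b) b)" .
  have "ftrace U T = (\<Sum>b\<in>B. fsc.representation B (T b) b)"
    using fin B spanB lin TU by (intro ftrace_eq) auto
  also have "\<dots> = (\<Sum>b\<in>A. fsc.representation B (T b) b) + (\<Sum>c\<in>C. fsc.representation B (T c) c)"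
    unfolding C_def using fin B(1) by (subst sum.subset_diff[of A B]) (auto simp: add.commute)
  finally show ?thesis using 1 2 by (simp add: K_def)
qed

lemma ftrace_isomorphism:
  fixes U :: "('b \<Rightarrow> 'a::field) set" and \<Phi> :: "('b \<Rightarrow> 'a) \<Rightarrow> ('c \<Rightarrow> 'a)"
  assumes "fsc.subspace U" "U \<subseteq> fsupp M" "finite M" "flinear \<Phi>" "flinear T" "flinear T'"
    and "\<And>x. x \<in> U \<Longrightarrow> T x \<in> U" "\<And>x. x \<in> U \<Longrightarrow> \<Phi> (T x) = T' (\<Phi> x)"
    and "\<And>x. x \<in> U \<Longrightarrow> \<Phi> x = 0 \<Longrightarrow> x = 0"
  shows "ftrace (\<Phi> ` U) T' = ftrace U T"
proof -
  interpret \<Phi>: Vector_Spaces.linear fsc fsc \<Phi> by fact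
  have "{x \<in> U. \<Phi> x = 0} = {0}"
    using assms(9) fsc.subspace_0[OF assms(1)] by (auto simp: \<Phi>.zero)
  then show ?thesis using ftrace_rank_nullity[where \<Phi> = \<Phi> and T = T and T' = T', OF assms(1-8)] by (simp add: ftrace_zero)
qed

section \<open>Inversion signs\<close>

text \<open>A tie \<open>g i = g j\<close> counts as no inversion. Ties do occur: \<open>g\<close>
  will also send generators of the Grassmann algebra to the factor that supplies them, or to its
  position.\<close>

definition cross_sign :: "(nat \<Rightarrow> nat) \<Rightarrow> nat \<Rightarrow> nat \<Rightarrow> 'a::comm_ring_1" where
  "cross_sign g i j = (if i < j \<and> g j < g i \<or> j < i \<and> g i < g j then -1 else 1)"

text \<open>For \<open>g\<close> injective on I = {i_1 < ... < i_m} this is the sign that sorts the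
  product of e_(g i_1), ..., e_(g i_m), taken in this order, into increasing order.\<close>

definition inv_sign :: "(nat \<Rightarrow> nat) \<Rightarrow> nat set \<Rightarrow> 'a::comm_ring_1" where
  "inv_sign g I = (\<Prod>(i, j)\<in>{(i, j). i \<in> I \<and> j \<in> I \<and> i < j}. cross_sign g i j)"

lemma cross_sign_commute: "cross_sign g i j = cross_sign g j i"
  by (auto simp: cross_sign_def)

lemma cross_sign_self [simp]: "cross_sign g i i = 1"
  by (simp add: cross_sign_def)

lemma cross_sign_square [simp]: "cross_sign g i j * cross_sign g i j = 1"
  by (simp add: cross_sign_def)

lemma finite_less_pairs: "finite I \<Longrightarrow> finite {(i, j). i \<in> I \<and> j \<in> I \<and> i < (j::nat)}"
  by (rule finite_subset[of _ "I \<times> I"]) auto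

lemma inv_sign_cong: "(\<And>i. i \<in> I \<Longrightarrow> g i = h i) \<Longrightarrow> inv_sign g I = inv_sign h I"
  unfolding inv_sign_def by (rule prod.cong) (auto simp: cross_sign_def)

lemma inv_sign_empty [simp]: "inv_sign g {} = 1"
  by (simp add: inv_sign_def)

lemma inv_sign_insert:
  assumes "finite I" "i \<notin> I"
  shows "inv_sign g (insert i I) = (\<Prod>x\<in>I. cross_sign g i x) * inv_sign g I"
proof -
  let ?P = "\<lambda>I. {(a, b). a \<in> I \<and> b \<in> I \<and> a < (b::nat)}"
  \<comment> \<open>The new pairs are the {i, x} with x in \<open>I\<close>, each listed in
    increasing order.\<close>
  let ?h = "\<lambda>x. (min i x, max i x)"
  have eq: "?P (insert i I) = ?h ` I \<union> ?P I"
  proof (intro equalityI subrelI)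
    fix a b assume "(a, b) \<in> ?P (insert i I)"
    then consider "(a, b) \<in> ?P I" | "a = i \<and> b \<in> I \<or> b = i \<and> a \<in> I" "a < b" by auto
    then show "(a, b) \<in> ?h ` I \<union> ?P I"
    proof cases
      case 2
      then have "(a, b) = ?h (if a = i then b else a)" "(if a = i then b else a) \<in> I"
        using assms(2) by (auto simp: min_def max_def)
      then show ?thesis by (intro UnI1 image_eqI)
    qed simp
  next
    fix a b assume "(a, b) \<in> ?h ` I \<union> ?P I"
    then show "(a, b) \<in> ?P (insert i I)"
      using assms(2) by (auto simp: min_def max_def le_less split: if_splits)
  qed
  have inj: "inj_on ?h I" using assms(2) by (auto simp: inj_on_def min_def max_def split: if_splits)
  have "inv_sign g (insert i I) = (\<Prod>(a, b)\<in>?h ` I. cross_sign g a b) * inv_sign g I"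
    unfolding inv_sign_def eq using assms
    by (intro prod.union_disjoint finite_less_pairs) (auto simp: min_def max_def split: if_splits)
  also have "(\<Prod>(a, b)\<in>?h ` I. cross_sign g a b) = (\<Prod>x\<in>I. cross_sign g i x)"
    by (subst prod.reindex[OF inj], rule prod.cong)
      (auto simp: min_def max_def cross_sign_commute)
  finally show ?thesis .
qed

lemma inv_sign_square [simp]: "inv_sign g I * inv_sign g I = 1"
  unfolding inv_sign_def by (subst prod.distrib[symmetric]) (auto intro: prod.neutral)

lemma inv_sign_nonzero [simp]: "inv_sign g I \<noteq> (0 :: 'a::field)"
  using inv_sign_square[of g I, where 'a='a] by (metis mult_zero_left zero_neq_one)

lemma inv_sign_mono_on:
  assumes "\<And>i j. i \<in> I \<Longrightarrow> j \<in> I \<Longrightarrow> i < j \<Longrightarrow> g i \<le> g j"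
  shows "inv_sign g I = 1"
  unfolding inv_sign_def using assms by (force intro: prod.neutral simp: cross_sign_def not_less)

lemma inv_sign_id [simp]: "inv_sign id I = 1"
  by (rule inv_sign_mono_on) auto

section \<open>Parities of fibres and signs of composed maps\<close>

definition odd_fibres :: "(nat \<Rightarrow> nat) \<Rightarrow> nat set \<Rightarrow> nat set" where
  "odd_fibres h S = {i. odd (card {t \<in> S. h t = i})}"

lemma odd_fibres_empty [simp]: "odd_fibres h {} = {}"
  by (simp add: odd_fibres_def)

lemma odd_fibres_subset: "odd_fibres h S \<subseteq> h ` S"
proof
  fix i assume "i \<in> odd_fibres h S"
  then have "{t \<in> S. h t = i} \<noteq> {}" unfolding odd_fibres_def by (auto dest!: odd_card_imp_not_empty)
  then show "i \<in> h ` S" by auto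
qed

lemma odd_fibres_insert:
  assumes "finite S" "t \<notin> S"
  shows "odd_fibres h (insert t S) =
    (if h t \<in> odd_fibres h S then odd_fibres h S - {h t} else insert (h t) (odd_fibres h S))"
proof -
  have "{s \<in> insert t S. h s = i} =
      (if h t = i then insert t {s \<in> S. h s = i} else {s \<in> S. h s = i})" for i
    by auto
  then have "card {s \<in> insert t S. h s = i} =
      (if h t = i then Suc (card {s \<in> S. h s = i}) else card {s \<in> S. h s = i})" for i
    using assms by simp
  then show ?thesis by (auto simp: odd_fibres_def)
qed

lemma finite_odd_fibres: "finite S \<Longrightarrow> finite (odd_fibres h S)"
  using finite_subset[OF odd_fibres_subset] by blast

text \<open>A new point of \<open>S\<close> toggles the membership of its image, so the cardinality
  changes by exactly one. This converts a condition on the degree of a coefficient into one on the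
  number of variables with odd values.\<close>

lemma card_odd_fibres:
  "finite S \<Longrightarrow> card (odd_fibres h S) \<le> card S \<and> (even (card (odd_fibres h S)) \<longleftrightarrow> even (card S))"
proof (induction S rule: finite_induct)
  case (insert t S)
  have "card (odd_fibres h S) > 0" if "h t \<in> odd_fibres h S"
    using that insert finite_odd_fibres card_gt_0_iff by blast
  then show ?case using insert
    by (auto simp: odd_fibres_insert card_Diff_singleton finite_odd_fibres card_insert_if)
qed simp

lemma odd_fibres_inj_on:
  assumes "inj_on h S"
  shows "odd_fibres h S = h ` S"
proof -
  have "{t \<in> S. h t = i} = (if i \<in> h ` S then {the_inv_into S h i} else {})" for i
    using assms by (auto simp: the_inv_into_f_f f_the_inv_into_f inj_on_eq_iff)
  then show ?thesis by (auto simp: odd_fibres_def)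
qed

text \<open>Each \<open>F i\<close> is its own inverse, so equal factors cancel in pairs and only
  the parity of a fibre matters.\<close>

lemma prod_odd_fibres:
  fixes F :: "nat \<Rightarrow> 'a::comm_ring_1"
  assumes "finite S" "\<And>i. F i * F i = 1"
  shows "(\<Prod>u\<in>S. F (h u)) = (\<Prod>i\<in>odd_fibres h S. F i)"
  using assms(1)
proof (induction S rule: finite_induct)
  case (insert t S)
  note fin = finite_odd_fibres[OF insert.hyps(1), of h]
  show ?case
  proof (cases "h t \<in> odd_fibres h S")
    case True
    then show ?thesis using insert fin assms(2)[of "h t"]
      by (simp add: odd_fibres_insert prod.remove[OF fin True] flip: mult.assoc)
  qed (use insert fin in \<open>simp add: odd_fibres_insert\<close>)
qed simp

text \<open>Injectivity of \<open>\<sigma>\<close> creates no new ties, and where \<open>h\<close>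
  has a tie all three signs are 1. Elsewhere two inversions of the same pair restore its
  order.\<close>

lemma cross_sign_comp:
  assumes "inj \<sigma>" "t \<noteq> u"
  shows "cross_sign (\<sigma> \<circ> h) t u = cross_sign \<sigma> (h t) (h u) * cross_sign h t u"
proof (cases "h t = h u")
  case False
  then have "\<sigma> (h t) \<noteq> \<sigma> (h u)" using assms(1) by (simp add: inj_eq)
  then show ?thesis using False assms(2) by (auto simp: cross_sign_def)
qed (auto simp: cross_sign_def)

text \<open>Reordering a product of homogeneous elements of a Grassmann algebra only sees the factors of
  odd degree: here \<open>h\<close> assigns to each generator in \<open>S\<close> the factor it belongs to.\<close>

lemma inv_sign_comp:
  assumes "finite S" "inj \<sigma>"
  shows "inv_sign (\<sigma> \<circ> h) S = (inv_sign \<sigma> (odd_fibres h S) * inv_sign h S :: 'a::comm_ring_1)"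
  using assms(1)
proof (induction S rule: finite_induct)
  case (insert t S)
  let ?O = "odd_fibres h S" let ?c = "cross_sign \<sigma> (h t) :: nat \<Rightarrow> 'a"
  note fin = finite_odd_fibres[OF insert.hyps(1), of h]
  have "(\<Prod>u\<in>S. cross_sign (\<sigma> \<circ> h) t u) = (\<Prod>u\<in>S. ?c (h u) * cross_sign h t u)"
    using insert assms(2) by (intro prod.cong cross_sign_comp) auto
  also have "\<dots> = (\<Prod>i\<in>?O. ?c i) * (\<Prod>u\<in>S. cross_sign h t u)"
    using insert by (simp add: prod.distrib prod_odd_fibres[where F = ?c])
  finally have *: "inv_sign (\<sigma> \<circ> h) (insert t S) =
      (\<Prod>i\<in>?O. ?c i) * inv_sign \<sigma> ?O * inv_sign h (insert t S)"
    using insert by (simp add: inv_sign_insert algebra_simps comp_def)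
  have "(\<Prod>i\<in>?O. ?c i) * inv_sign \<sigma> ?O = inv_sign \<sigma> (odd_fibres h (insert t S))"
  proof (cases "h t \<in> ?O")
    case True
    \<comment> \<open>Here \<open>h t\<close> leaves the set of odd fibres: its cross signs with the
      remaining elements occur twice and cancel.\<close>
    have "inv_sign \<sigma> ?O = (\<Prod>i\<in>?O - {h t}. ?c i) * inv_sign \<sigma> (?O - {h t})"
      using inv_sign_insert[of "?O - {h t}" "h t"] fin True by (simp add: insert_absorb)
    moreover have "(\<Prod>i\<in>?O. ?c i) = (\<Prod>i\<in>?O - {h t}. ?c i)"
      using fin True by (simp add: prod.remove)
    moreover have "(\<Prod>i\<in>?O - {h t}. ?c i) * (\<Prod>i\<in>?O - {h t}. ?c i) = 1"
      by (simp flip: prod.distrib)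
    ultimately show ?thesis using insert True by (simp add: odd_fibres_insert flip: mult.assoc)
  qed (use insert fin in \<open>simp add: odd_fibres_insert inv_sign_insert\<close>)
  then show ?case using * by (simp add: comp_def)
qed simp

lemma inv_sign_comp_inj:
  assumes "finite I" "inj \<sigma>" "inj_on \<tau> I"
  shows "inv_sign (\<sigma> \<circ> \<tau>) I = inv_sign \<sigma> (\<tau> ` I) * inv_sign \<tau> I"
  by (simp only: inv_sign_comp[OF assms(1,2)] odd_fibres_inj_on[OF assms(3)])

text \<open>An x of \<open>I\<close> strictly between a and b is inverted with both of them, any
  other x with neither; only the pair of a and b itself is left.\<close>

lemma inv_sign_transpose:
  assumes "finite I" "a \<in> I" "b \<in> I" "a \<noteq> b"
  shows "inv_sign (transpose a b) I = (-1 :: 'a::comm_ring_1)"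
proof -
  let ?c = "cross_sign (transpose a b) :: nat \<Rightarrow> nat \<Rightarrow> 'a"
  define X where "X = I - {a, b}"
  have X: "finite X" "a \<notin> X" "b \<notin> X" "I = insert a (insert b X)"
    using assms by (auto simp: X_def)
  have "inv_sign (transpose a b) X = (1 :: 'a)"
    using X by (intro inv_sign_mono_on) (metis less_imp_le transpose_apply_other)
  then have "inv_sign (transpose a b) I = ?c a b * ((\<Prod>x\<in>X. ?c a x) * (\<Prod>x\<in>X. ?c b x))"
    using X assms(4) by (simp add: inv_sign_insert mult.assoc)
  also have "(\<Prod>x\<in>X. ?c a x) * (\<Prod>x\<in>X. ?c b x) = 1"
    unfolding prod.distrib[symmetric] using X assms(4)
    by (intro prod.neutral) (auto simp: cross_sign_def transpose_def)
  also have "?c a b = -1" using assms(4) by (auto simp: cross_sign_def)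
  finally show ?thesis by simp
qed

text \<open>An adjacent transposition preserves the order on any set that misses one of its two
  points. Against the value -1 on sets containing both, this sign tells the two kinds of sets
  apart.\<close>

lemma inv_sign_transpose_Suc:
  assumes "\<not> (a \<in> I \<and> Suc a \<in> I)"
  shows "inv_sign (transpose a (Suc a)) I = 1"
  using assms by (intro inv_sign_mono_on) (auto simp: transpose_def)

text \<open>Both signs are multiplicative and equal -1 at a transposition of two distinct points of
  \<open>E\<close>.\<close>

lemma inv_sign_permutes:
  assumes "finite E" "q permutes E"
  shows "inv_sign q E = (of_int (sign q) :: 'a::comm_ring_1)"
  using assms(2,1)
proof (induction rule: permutes_induct)
  case (swap a b p)
  have p: "p permutes E" by fact
  have "permutation p" using p assms(1) permutation_permutes by blast
  then have "sign (transpose a b \<circ> p) = (if a = b then 1 else -1) * sign p"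
    by (simp add: sign_compose permutation_swap_id sign_swap_id)
  moreover have "inv_sign (transpose a b \<circ> p) E = (inv_sign (transpose a b) E * inv_sign p E :: 'a)"
    using inv_sign_comp_inj[of E "transpose a b" p] assms(1) permutes_inj_on[OF p]
    by (simp add: permutes_image[OF p])
  ultimately show ?case using swap assms(1) by (auto simp: inv_sign_transpose comp_def)
qed (simp add: inv_sign_mono_on)

section \<open>Evaluation in the Grassmann algebra\<close>

text \<open>No pair inside \<open>T\<close> is inverted, and a pair across \<open>T\<close> and
  \<open>S - T\<close> is inverted exactly if its element of \<open>S - T\<close> is the smaller
  one. The number of such pairs is the exponent in \<open>grass_sign\<close>. Here \<open>T\<close>
  will hold the generators supplied by the leftmost factor.\<close>

lemma inv_sign_split:
  assumes "finite S" "T \<subseteq> S" "\<And>t u. t \<in> T \<Longrightarrow> u \<in> T \<Longrightarrow> g t = g u"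
    and "\<And>t u. t \<in> T \<Longrightarrow> u \<in> S - T \<Longrightarrow> g t < g u"
  shows "inv_sign g S = (grass_sign T (S - T) * inv_sign g (S - T) :: 'a::comm_ring_1)"
proof -
  let ?P = "\<lambda>I. {(a, b). a \<in> I \<and> b \<in> I \<and> a < (b::nat)}"
  let ?A = "{(u, t). u \<in> S - T \<and> t \<in> T \<and> u < t}"
  have fin: "finite (?P S)" using assms(1) by (rule finite_less_pairs)
  have "inv_sign g S = (\<Prod>(i, j)\<in>?P S - ?P (S - T). cross_sign g i j) * (inv_sign g (S - T) :: 'a)"
    unfolding inv_sign_def by (rule prod.subset_diff[OF _ fin]) auto
  also have "(\<Prod>(i, j)\<in>?P S - ?P (S - T). cross_sign g i j) = (\<Prod>p\<in>?A. -1 :: 'a)"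
  proof (rule prod.mono_neutral_cong_right)
    show "finite (?P S - ?P (S - T))" using fin by simp
    show "?A \<subseteq> ?P S - ?P (S - T)" using assms(2) by auto
    show "\<forall>p\<in>?P S - ?P (S - T) - ?A. (case p of (i, j) \<Rightarrow> cross_sign g i j) = (1 :: 'a)"
    proof
      fix p assume "p \<in> ?P S - ?P (S - T) - ?A"
      then obtain a b where p: "p = (a, b)" "a \<in> S" "b \<in> S" "a < b" "a \<in> T" by auto
      then have "g a \<le> g b"
        using assms(3)[of a b] assms(4)[of a b] by (cases "b \<in> T") auto
      then show "(case p of (i, j) \<Rightarrow> cross_sign g i j) = (1 :: 'a)"
        using p by (simp add: cross_sign_def)
    qed
    show "(case p of (i, j) \<Rightarrow> cross_sign g i j) = (-1 :: 'a)" if "p \<in> ?A" for p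
      using that assms(4) by (auto simp: cross_sign_def)
  qed
  also have "\<dots> = (-1) ^ card ?A" by simp
  also have "card ?A = card {(t, u). t \<in> T \<and> u \<in> S - T \<and> u < t}"
    by (rule bij_betw_same_card[of prod.swap]) (auto simp: bij_betw_def inj_on_def image_def)
  finally show ?thesis by (simp add: grass_sign_def)
qed

text \<open>A term at e_S arises by choosing for each generator t the factor \<open>h t\<close> that
  supplies it; sorting the generators then costs the inversions of the positions
  \<open>r (h t)\<close>. In the application \<open>xs\<close> lists the variables of a monomial
  given by \<open>\<sigma>\<close>, and \<open>r\<close> is \<open>inv \<sigma>\<close>.\<close>

lemma foldr_grass_mult_coeff:
  fixes u :: "nat \<Rightarrow> nat set \<Rightarrow> 'a::comm_ring_1"
  assumes "finite S" "distinct xs" "sorted_wrt (\<lambda>x y. r x < r y) xs"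
  shows "foldr grass_mult (map u xs) grass_one S =
    (\<Sum>h\<in>S \<rightarrow>\<^sub>E set xs. inv_sign (r \<circ> h) S * (\<Prod>i\<in>set xs. u i {t \<in> S. h t = i}))"
  using assms
proof (induction xs arbitrary: S)
  case Nil
  then show ?case by (auto simp: grass_one_def PiE_empty_domain PiE_eq_empty_iff)
next
  case (Cons x xs)
  let ?F = "\<lambda>h. inv_sign (r \<circ> h) S * (\<Prod>i\<in>set (x # xs). u i {t \<in> S. h t = i})"
  let ?G = "\<lambda>T h. grass_sign T (S - T) * u x T *
     (inv_sign (r \<circ> h) (S - T) * (\<Prod>i\<in>set xs. u i {t \<in> S - T. h t = i}))"
  have "foldr grass_mult (map u (x # xs)) grass_one S =
      (\<Sum>T\<in>Pow S. grass_sign T (S - T) * u x T * foldr grass_mult (map u xs) grass_one (S - T))"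
    by (simp add: grass_mult_def)
  also have "\<dots> = (\<Sum>T\<in>Pow S. \<Sum>h\<in>(S - T) \<rightarrow>\<^sub>E set xs. ?G T h)"
    using Cons by (simp add: sum_distrib_left comp_def)
  also have "\<dots> = (\<Sum>(T, h)\<in>Sigma (Pow S) (\<lambda>T. (S - T) \<rightarrow>\<^sub>E set xs). ?G T h)"
    using Cons.prems(1) by (intro sum.Sigma) (auto intro!: finite_PiE)
  also have "\<dots> = (\<Sum>h\<in>S \<rightarrow>\<^sub>E set (x # xs). ?F h)"
  \<comment> \<open>A pair \<open>(T, h)\<close>, the generators taken from the first factor and an
    assignment of the others, corresponds to an assignment on all of \<open>S\<close>;
    \<open>restrict\<close> keeps functions extensional.\<close>
  proof (rule sum.reindex_bij_witness[where i = "\<lambda>h. ({t \<in> S. h t = x}, restrict h {t \<in> S. h t \<noteq> x})"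
        and j = "\<lambda>(T, h). \<lambda>t. if t \<in> T then x else h t"])
    fix p assume p: "p \<in> Sigma (Pow S) (\<lambda>T. (S - T) \<rightarrow>\<^sub>E set xs)"
    obtain T h where [simp]: "p = (T, h)" by (cases p)
    have T: "T \<subseteq> S" and h: "h \<in> (S - T) \<rightarrow>\<^sub>E set xs" using p by auto
    have hx: "h t \<in> set xs" if "t \<in> S" "t \<notin> T" for t using h that by auto
    have xn: "x \<notin> set xs" using Cons.prems by simp
    have Teq: "{t \<in> S. (if t \<in> T then x else h t) = x} = T"
      using T hx xn by auto
    have Seq: "{t \<in> S. (if t \<in> T then x else h t) \<noteq> x} = S - T"
      using T hx xn by auto
    let ?h = "\<lambda>t. if t \<in> T then x else h t"
    have "restrict ?h (S - T) = h"
      using h by (intro ext) (auto simp: restrict_def PiE_def extensional_def)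
    then show "({t \<in> S. (case p of (T, h) \<Rightarrow> \<lambda>t. if t \<in> T then x else h t) t = x},
        restrict (case p of (T, h) \<Rightarrow> \<lambda>t. if t \<in> T then x else h t)
          {t \<in> S. (case p of (T, h) \<Rightarrow> \<lambda>t. if t \<in> T then x else h t) t \<noteq> x}) = p"
      by (simp add: Teq Seq)
    show "(case p of (T, h) \<Rightarrow> \<lambda>t. if t \<in> T then x else h t) \<in> S \<rightarrow>\<^sub>E set (x # xs)"
      using h T hx by (auto simp: PiE_def extensional_def)
    have rx: "r x < r (h t)" if "t \<in> S" "t \<notin> T" for t
      using hx[OF that] Cons.prems by auto
    have "inv_sign (r \<circ> ?h) S = grass_sign T (S - T) * inv_sign (r \<circ> ?h) (S - T)"
      using Cons.prems(1) T rx by (intro inv_sign_split) auto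
    also have "inv_sign (r \<circ> ?h) (S - T) = inv_sign (r \<circ> h) (S - T)"
      by (rule inv_sign_cong) auto
    finally have sg: "inv_sign (r \<circ> ?h) S =
      (grass_sign T (S - T) * inv_sign (r \<circ> h) (S - T) :: 'a)" .
    have "{t \<in> S. ?h t = i} = {t \<in> S - T. h t = i}" if "i \<in> set xs" for i
      using that xn by auto
    then have "(\<Prod>i\<in>set (x # xs). u i {t \<in> S. ?h t = i}) =
        u x T * (\<Prod>i\<in>set xs. u i {t \<in> S - T. h t = i})"
      using xn Teq by simp
    then show "?F (case p of (T, h) \<Rightarrow> \<lambda>t. if t \<in> T then x else h t) = (case p of (T, h) \<Rightarrow> ?G T h)"
      using sg by (simp add: algebra_simps)
  next
    fix h assume h: "h \<in> S \<rightarrow>\<^sub>E set (x # xs)"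
    then show "(case ({t \<in> S. h t = x}, restrict h {t \<in> S. h t \<noteq> x}) of
        (T, h) \<Rightarrow> \<lambda>t. if t \<in> T then x else h t) = h"
      by (intro ext) (auto simp: restrict_def PiE_def extensional_def)
    show "({t \<in> S. h t = x}, restrict h {t \<in> S. h t \<noteq> x}) \<in> Sigma (Pow S) (\<lambda>T. (S - T) \<rightarrow>\<^sub>E set xs)"
      using h by (auto simp: PiE_def Pi_def)
  qed
  finally show ?case .
qed

text \<open>The functional L_I of the overview. As \<open>inv \<sigma> i\<close> is the position of
  variable i in the monomial, the sign compares the order in which the variables of \<open>I\<close>
  occur with the natural one.\<close>

definition sgn_form :: "nat \<Rightarrow> ((nat \<Rightarrow> nat) \<times> nat set \<Rightarrow> 'a::comm_ring_1) \<Rightarrow> nat set \<Rightarrow> 'a" where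
  "sgn_form n f I = (\<Sum>\<sigma> | \<sigma> permutes {1..n}. f (\<sigma>, {}) * inv_sign (inv \<sigma>) I)"

lemma grassmann_trivial_simps [simp]:
  "sa0 (grassmann_trivial k) = grass_carrier k" "sa1 (grassmann_trivial k) = {0}"
  "samul (grassmann_trivial k) = grass_mult" "saone (grassmann_trivial k) = grass_one"
  by (simp_all add: grassmann_trivial_def)

lemma finite_permutes [simp]: "finite {\<sigma>. \<sigma> permutes {m..n::nat}}"
  by (rule finite_permutations) simp

lemma finite_gr_monos [simp]: "finite (gr_monos n)"
  by (rule finite_subset[of _ "{\<sigma>. \<sigma> permutes {1..n}} \<times> Pow {1..n}"]) (auto simp: gr_monos_def)

lemma foldr_grass_mult_zero: "0 \<in> set gs \<Longrightarrow> foldr grass_mult gs z = 0"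
  by (induction gs) (auto simp: grass_mult_def fun_eq_iff)

text \<open>An odd variable contributes a factor 0, and one such factor annihilates the
  product.\<close>

lemma poly_eval_even:
  fixes f :: "(nat \<Rightarrow> nat) \<times> nat set \<Rightarrow> 'a::comm_ring_1"
  assumes "\<And>i. v i = 0"
  shows "poly_eval (grassmann_trivial k) n f u v S =
    (\<Sum>\<sigma> | \<sigma> permutes {1..n}. f (\<sigma>, {}) * foldr grass_mult (map u (map \<sigma> [1..<Suc n])) grass_one S)"
proof -
  let ?G = "grassmann_trivial k :: (nat set, 'a) superalg"
  have zero: "mono_eval ?G n (\<sigma>, Od) u v S = 0"
    if \<sigma>: "\<sigma> permutes {1..n}" and Od: "Od \<subseteq> {1..n}" "Od \<noteq> {}" for \<sigma> Od
  proof -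
    obtain i where i: "i \<in> Od" using Od by blast
    then obtain p where p: "p \<in> {1..n}" "\<sigma> p = i"
      using Od permutes_image[OF \<sigma>] by (metis imageE subsetD)
    have "foldr grass_mult (map (\<lambda>p. if \<sigma> p \<in> Od then v (\<sigma> p) else u (\<sigma> p)) [1..<Suc n]) grass_one = 0"
      using i p by (intro foldr_grass_mult_zero) (auto simp: assms image_iff simp del: upt_Suc intro!: bexI[of _ p])
    then show ?thesis by (simp add: mono_eval_def)
  qed
  have "poly_eval ?G n f u v S =
      (\<Sum>m\<in>(\<lambda>\<sigma>. (\<sigma>, {})) ` {\<sigma>. \<sigma> permutes {1..n}}. f m * mono_eval ?G n m u v S)"
    unfolding poly_eval_def
  proof (rule sum.mono_neutral_right)
    show "\<forall>m\<in>gr_monos n - (\<lambda>\<sigma>. (\<sigma>, {})) ` {\<sigma>. \<sigma> permutes {1..n}}. f m * mono_eval ?G n m u v S = 0"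
    proof
      fix m assume m: "m \<in> gr_monos n - (\<lambda>\<sigma>. (\<sigma>, {})) ` {\<sigma>. \<sigma> permutes {1..n}}"
      obtain \<sigma> Od where [simp]: "m = (\<sigma>, Od)" by (cases m)
      show "f m * mono_eval ?G n m u v S = 0" using m zero[of \<sigma> Od] by (cases "Od = {}") (auto simp: gr_monos_def)
    qed
  qed (auto simp: gr_monos_def)
  also have "\<dots> = (\<Sum>\<sigma> | \<sigma> permutes {1..n}. f (\<sigma>, {}) * mono_eval ?G n (\<sigma>, {}) u v S)"
    by (subst sum.reindex) (auto simp: inj_on_def)
  finally show ?thesis by (simp add: mono_eval_def comp_def)
qed

text \<open>The sign of the composition \<open>inv \<sigma> \<circ> h\<close> splits into the sign
  of \<open>h\<close>, common to all monomials, and a sign depending on \<open>h\<close> through its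
  odd fibres only. Summation over \<open>\<sigma>\<close> then yields \<open>sgn_form\<close> at
  these fibres.\<close>

lemma poly_eval_coeff:
  fixes f :: "(nat \<Rightarrow> nat) \<times> nat set \<Rightarrow> 'a::comm_ring_1"
  assumes "finite S" "\<And>i. v i = 0"
  shows "poly_eval (grassmann_trivial k) n f u v S =
    (\<Sum>h\<in>S \<rightarrow>\<^sub>E {1..n}. inv_sign h S * (\<Prod>i\<in>{1..n}. u i {t \<in> S. h t = i})
        * sgn_form n f (odd_fibres h S))"
proof -
  have *: "foldr grass_mult (map u (map \<sigma> [1..<Suc n])) grass_one S =
      (\<Sum>h\<in>S \<rightarrow>\<^sub>E {1..n}. inv_sign (inv \<sigma>) (odd_fibres h S) * inv_sign h S *
         (\<Prod>i\<in>{1..n}. u i {t \<in> S. h t = i}))"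
    if \<sigma>: "\<sigma> permutes {1..n}" for \<sigma>
  proof -
    have "set (map \<sigma> [1..<Suc n]) = {1..n}"
      using permutes_image[OF \<sigma>] by (simp add: atLeastLessThanSuc_atLeastAtMost del: upt_Suc)
    moreover have "distinct (map \<sigma> [1..<Suc n])"
      using permutes_inj_on[OF \<sigma>] by (simp add: distinct_map)
    moreover have "sorted_wrt (\<lambda>x y. inv \<sigma> x < inv \<sigma> y) (map \<sigma> [1..<Suc n])"
      by (simp add: sorted_wrt_map permutes_inverses[OF \<sigma>] del: upt_Suc)
    ultimately show ?thesis
      using foldr_grass_mult_coeff[of S "map \<sigma> [1..<Suc n]" "inv \<sigma>" u] assms(1)
        permutes_inj[OF permutes_inv[OF \<sigma>]]
      by (simp only: inv_sign_comp)
  qed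
  have "poly_eval (grassmann_trivial k) n f u v S =
    (\<Sum>\<sigma> | \<sigma> permutes {1..n}. \<Sum>h\<in>S \<rightarrow>\<^sub>E {1..n}. f (\<sigma>, {}) *
       (inv_sign (inv \<sigma>) (odd_fibres h S) * inv_sign h S * (\<Prod>i\<in>{1..n}. u i {t \<in> S. h t = i})))"
    unfolding poly_eval_even[OF assms(2)] sum_distrib_left[symmetric]
    by (rule sum.cong) (auto simp only: * mem_Collect_eq)
  also have "\<dots> = (\<Sum>h\<in>S \<rightarrow>\<^sub>E {1..n}. \<Sum>\<sigma> | \<sigma> permutes {1..n}. f (\<sigma>, {}) *
       (inv_sign (inv \<sigma>) (odd_fibres h S) * inv_sign h S * (\<Prod>i\<in>{1..n}. u i {t \<in> S. h t = i})))"
    by (rule sum.swap)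
  also have "\<dots> = (\<Sum>h\<in>S \<rightarrow>\<^sub>E {1..n}. inv_sign h S * (\<Prod>i\<in>{1..n}. u i {t \<in> S. h t = i})
        * sgn_form n f (odd_fibres h S))"
    by (rule sum.cong) (simp_all add: sgn_form_def sum_distrib_left algebra_simps)
  finally show ?thesis .
qed

lemma poly_eval_carrier:
  assumes "1 \<le> n" "\<And>i. v i = 0" "\<And>i. u i \<in> grass_carrier k"
  shows "poly_eval (grassmann_trivial k) n f u v \<in> grass_carrier k"
proof -
  have "poly_eval (grassmann_trivial k) n f u v S = 0" if S: "\<not> S \<subseteq> {1..2*k}" for S
  proof (cases "finite S")
    case True
    have "(\<Prod>i\<in>{1..n}. u i {t \<in> S. h t = i}) = 0" if h: "h \<in> S \<rightarrow>\<^sub>E {1..n}" for h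
    proof -
      obtain t where t: "t \<in> S" "t \<notin> {1..2*k}" using S by blast
      then have "h t \<in> {1..n}" using h by auto
      moreover have "u (h t) {s \<in> S. h s = h t} = 0"
        using assms(3)[of "h t"] t unfolding grass_carrier_def by blast
      ultimately show ?thesis by (meson finite_atLeastAtMost prod_zero)
    qed
    then show ?thesis unfolding poly_eval_coeff[OF True assms(2)] by simp
  next
    case False
    \<comment> \<open>Coefficient functions have values at infinite sets too. There the outermost
      \<open>grass_mult\<close> sums over the infinite \<open>Pow S\<close> and defaults to
      0.\<close>
    have "[1..<Suc n] = 1 # [Suc 1..<Suc n]" using assms(1) by (simp add: upt_conv_Cons del: upt_Suc)
    then have "foldr grass_mult (map u (map \<sigma> [1..<Suc n])) grass_one S = 0" for \<sigma>
      using False by (simp add: grass_mult_def finite_Pow_iff del: upt_Suc)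
    then show ?thesis unfolding poly_eval_even[OF assms(2)] by (simp del: upt_Suc)
  qed
  then show ?thesis by (auto simp: grass_carrier_def)
qed

lemma poly_eval_eq_0:
  assumes "finite S" "\<And>i. v i = 0"
    and "\<And>I. I \<subseteq> {1..n} \<Longrightarrow> card I \<le> card S \<Longrightarrow> (even (card I) \<longleftrightarrow> even (card S)) \<Longrightarrow> sgn_form n f I = 0"
  shows "poly_eval (grassmann_trivial k) n f u v S = 0"
  unfolding poly_eval_coeff[OF assms(1,2)]
proof (rule sum.neutral, rule ballI)
  fix h assume h: "h \<in> S \<rightarrow>\<^sub>E {1..n}"
  have "odd_fibres h S \<subseteq> {1..n}" using odd_fibres_subset[of h S] h by auto
  then have "sgn_form n f (odd_fibres h S) = 0"
    using card_odd_fibres[OF assms(1), of h] by (intro assms(3)) auto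
  then show "inv_sign h S * (\<Prod>i\<in>{1..n}. u i {t \<in> S. h t = i}) * sgn_form n f (odd_fibres h S) = 0"
    by simp
qed

text \<open>Substituting distinct generators e_1, ..., e_|I| for the variables in \<open>I\<close>
  and 1 for all others leaves a single term in the coefficient of e_1 ... e_|I|, namely L_I up to
  sign. The bound on \<open>card I\<close> is the number of generators available.\<close>

lemma poly_eval_test:
  fixes f :: "(nat \<Rightarrow> nat) \<times> nat set \<Rightarrow> 'a::field"
  assumes I: "I \<subseteq> {1..n}" "card I \<le> 2 * k"
  obtains u where "\<And>i. u i \<in> grass_carrier k"
    "poly_eval (grassmann_trivial k) n f u (\<lambda>_. 0) {1..card I} = 0 \<Longrightarrow> sgn_form n f I = 0"
proof -
  have fin: "finite I" using I finite_subset by blast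
  define S where "S = {1..card I}"
  obtain g where g: "bij_betw g S I"
    using ex_bij_betw_nat_finite_1[OF fin] by (auto simp: S_def)
  \<comment> \<open>Over i in \<open>I\<close> the fibre of \<open>g\<close> is a singleton {t} and
    encodes e_t; over any other i it is empty and encodes 1.\<close>
  define u :: "nat \<Rightarrow> nat set \<Rightarrow> 'a" where
    "u i = (\<lambda>T. if T = {t \<in> S. g t = i} then 1 else 0)" for i
  have gS: "g t \<in> {1..n}" if "t \<in> S" for t using that g I bij_betwE by fastforce
  have u: "u i \<in> grass_carrier k" for i
    using I by (auto simp: u_def grass_carrier_def S_def split: if_splits)
  define r where "r = restrict g S"
  have uz: "(\<Prod>i\<in>{1..n}. u i {t \<in> S. h t = i}) = (if h = r then 1 else 0)"
    if h: "h \<in> S \<rightarrow>\<^sub>E {1..n}" for h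
  proof (cases "h = r")
    case True
    have "{t \<in> S. h t = i} = {t \<in> S. g t = i}" for i using True by (auto simp: r_def)
    then show ?thesis using True by (simp add: u_def)
  next
    case False
    then obtain t where t: "t \<in> S" "h t \<noteq> g t"
      using h unfolding r_def by (metis PiE_restrict restrict_ext)
    then have "t \<in> {s \<in> S. h s = h t}" "t \<notin> {s \<in> S. g s = h t}" by auto
    then have "u (h t) {s \<in> S. h s = h t} = 0" unfolding u_def by metis
    moreover have "h t \<in> {1..n}" using h t by auto
    ultimately have "(\<Prod>i\<in>{1..n}. u i {t \<in> S. h t = i}) = 0"
      by (intro prod_zero) (auto intro!: bexI[of _ "h t"])
    then show ?thesis using False by simp
  qed
  have finS: "finite S" by (simp add: S_def)
  have rg: "r \<in> S \<rightarrow>\<^sub>E {1..n}" using gS by (auto simp: r_def)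
  have "poly_eval (grassmann_trivial k) n f u (\<lambda>_. 0) S =
      (\<Sum>h\<in>S \<rightarrow>\<^sub>E {1..n}. if h = r then inv_sign h S * sgn_form n f (odd_fibres h S) else 0)"
    unfolding poly_eval_coeff[OF finS refl] by (rule sum.cong, simp, simp only: uz, simp)
  also have "\<dots> = inv_sign r S * sgn_form n f (odd_fibres r S)"
    using finS rg by (simp add: finite_PiE)
  also have "odd_fibres r S = I"
    using g odd_fibres_inj_on[of r S] by (simp add: bij_betw_def r_def)
  finally have "poly_eval (grassmann_trivial k) n f u (\<lambda>_. 0) S = 0 \<Longrightarrow> sgn_form n f I = 0"
    by simp
  then show thesis using that[of u] u unfolding S_def by blast
qed

section \<open>The center, and identities and central polynomials in terms of signed coefficient
  sums\<close>

lemma sa_carrier_grassmann [simp]: "sa_carrier (grassmann_trivial k) = grass_carrier k"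
  by (auto simp: sa_carrier_def)

text \<open>The pairs with u < t and those with t < u together fill T \<times> U. This is the rule
  that e_T and e_U commute up to the sign (-1)^(|T| |U|).\<close>

lemma grass_sign_swap:
  assumes "finite T" "finite U" "T \<inter> U = {}"
  shows "grass_sign T U = ((-1) ^ (card T * card U) * grass_sign U T :: 'a::comm_ring_1)"
proof -
  let ?A = "{(t, u). t \<in> T \<and> u \<in> U \<and> u < t}" let ?B = "{(u, t). u \<in> U \<and> t \<in> T \<and> t < u}"
  have "card (?A \<union> prod.swap ` ?B) = card ?A + card (prod.swap ` ?B)"
    using assms by (intro card_Un_disjoint finite_imageI)
      (auto intro: finite_subset[of _ "T \<times> U"] finite_subset[of _ "U \<times> T"])
  moreover have "?A \<union> prod.swap ` ?B = T \<times> U"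
  proof (intro equalityI subrelI)
    fix t u assume "(t, u) \<in> T \<times> U"
    then have "t \<in> T" "u \<in> U" "t \<noteq> u" using assms(3) by auto
    then show "(t, u) \<in> ?A \<union> prod.swap ` ?B" by (cases "u < t") (auto simp: image_iff)
  qed auto
  moreover have "card (prod.swap ` ?B) = card ?B"
    by (intro card_image) auto
  ultimately have "card T * card U = card ?A + card ?B" by (simp add: card_cartesian_product)
  then have "(-1) ^ (card T * card U) * (-1) ^ card ?B = ((-1) ^ card ?A :: 'a)"
    by (simp add: power_add mult.assoc flip: power_mult_distrib)
  then show ?thesis by (simp add: grass_sign_def)
qed

lemma grass_sign_nonzero: "grass_sign T U \<noteq> (0 :: 'a::field)"
  by (simp add: grass_sign_def)

lemma grass_mult_commute_even:
  fixes x y :: "nat set \<Rightarrow> 'a::comm_ring_1"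
  assumes "\<And>S. odd (card S) \<Longrightarrow> x S = 0"
  shows "grass_mult x y = grass_mult y x"
proof
  fix S
  have "(\<Sum>T\<in>Pow S. grass_sign T (S - T) * x T * y (S - T)) =
      (\<Sum>T\<in>Pow S. grass_sign T (S - T) * y T * x (S - T))" if "finite S"
  proof (rule sum.reindex_bij_witness[where i = "\<lambda>T. S - T" and j = "\<lambda>T. S - T"])
    fix T assume T: "T \<in> Pow S"
    then have [simp]: "S - (S - T) = T" by auto
    have "grass_sign T (S - T) * x T = (grass_sign (S - T) T * x T :: 'a)"
    proof (cases "even (card T)")
      case True
      then show ?thesis
        using grass_sign_swap[of T "S - T", where 'a='a] T that finite_subset[of T S]
        by (simp add: power_mult)
    qed (simp add: assms)
    then show "grass_sign (S - T) (S - (S - T)) * y (S - T) * x (S - (S - T)) =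
        grass_sign T (S - T) * x T * y (S - T)"
      by (simp add: algebra_simps)
  qed auto
  then show "grass_mult x y S = grass_mult y x S"
    by (cases "finite S") (auto simp: grass_mult_def)
qed

text \<open>The number of generators is even, so a set T of odd size misses some j in {1..2k}. Then
  e_j anticommutes with e_T, and commuting with e_j forces 2 x_T = 0, read off at the coefficient of
  T with j added.\<close>

lemma sa_center_grassmann:
  "sa_center (grassmann_trivial k :: (nat set, 'a::field_char_0) superalg) =
    {x \<in> grass_carrier k. \<forall>S. odd (card S) \<longrightarrow> x S = 0}"
proof (intro equalityI subsetI)
  fix x :: "nat set \<Rightarrow> 'a"
  assume "x \<in> sa_center (grassmann_trivial k)"
  then have x: "x \<in> grass_carrier k" and
    comm: "\<And>y. y \<in> grass_carrier k \<Longrightarrow> grass_mult x y = grass_mult y x"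
    by (auto simp: sa_center_def)
  have "x T = 0" if T: "odd (card T)" for T
  proof (rule ccontr)
    assume "x T \<noteq> 0"
    then have sub: "T \<subseteq> {1..2*k}" using x by (auto simp: grass_carrier_def)
    then have fin: "finite T" using finite_subset by blast
    have "T \<noteq> {1..2*k}" using T by auto
    then obtain j where j: "j \<in> {1..2*k}" "j \<notin> T" using sub by blast
    define y :: "nat set \<Rightarrow> 'a" where "y = (\<lambda>U. if U = {j} then 1 else 0)"
    have y: "y \<in> grass_carrier k" using j by (auto simp: y_def grass_carrier_def)
    let ?S = "insert j T"
    have "grass_mult x y ?S = (\<Sum>U\<in>Pow ?S. if U = T then grass_sign T {j} * x T else 0)"
      unfolding grass_mult_def using j by (intro sum.cong) (auto simp: y_def)
    then have 1: "grass_mult x y ?S = grass_sign T {j} * x T"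
      using fin by (simp add: subset_insertI)
    have "grass_mult y x ?S = (\<Sum>U\<in>Pow ?S. if U = {j} then grass_sign {j} T * x T else 0)"
      unfolding grass_mult_def using j by (intro sum.cong) (auto simp: y_def)
    then have 2: "grass_mult y x ?S = grass_sign {j} T * x T"
      using fin by simp
    have "grass_sign T {j} = (- grass_sign {j} T :: 'a)"
      using grass_sign_swap[of T "{j}", where 'a='a] fin j T by simp
    then show False
      using 1 2 comm[OF y] \<open>x T \<noteq> 0\<close> grass_sign_nonzero[of "{j}" T, where 'a='a] by simp
  qed
  then show "x \<in> {x \<in> grass_carrier k. \<forall>S. odd (card S) \<longrightarrow> x S = 0}" using x by simp
qed (auto simp: sa_center_def intro: grass_mult_commute_even)

lemma IdPgr_grassmann:
  assumes "1 \<le> n"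
  shows "IdPgr (grassmann_trivial k :: (nat set, 'a::field) superalg) n =
    {f \<in> Pgr n. \<forall>I. I \<subseteq> {1..n} \<longrightarrow> card I \<le> 2 * k \<longrightarrow> sgn_form n f I = 0}"
proof (intro equalityI subsetI)
  fix f :: "(nat \<Rightarrow> nat) \<times> nat set \<Rightarrow> 'a"
  assume f: "f \<in> IdPgr (grassmann_trivial k) n"
  have "sgn_form n f I = 0" if "I \<subseteq> {1..n}" "card I \<le> 2 * k" for I
  proof -
    obtain u where "\<And>i. u i \<in> grass_carrier k"
      "poly_eval (grassmann_trivial k) n f u (\<lambda>_. 0) {1..card I} = 0 \<Longrightarrow> sgn_form n f I = 0"
      using poly_eval_test[of I n k f] \<open>I \<subseteq> {1..n}\<close> \<open>card I \<le> 2 * k\<close> by blast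
    then show ?thesis using f by (simp add: IdPgr_def)
  qed
  then show "f \<in> {f \<in> Pgr n. \<forall>I. I \<subseteq> {1..n} \<longrightarrow> card I \<le> 2 * k \<longrightarrow> sgn_form n f I = 0}"
    using f by (auto simp: IdPgr_def)
next
  fix f :: "(nat \<Rightarrow> nat) \<times> nat set \<Rightarrow> 'a"
  assume f: "f \<in> {f \<in> Pgr n. \<forall>I. I \<subseteq> {1..n} \<longrightarrow> card I \<le> 2 * k \<longrightarrow> sgn_form n f I = 0}"
  have "poly_eval (grassmann_trivial k) n f u v S = 0"
    if uv: "\<And>i. u i \<in> grass_carrier k" "\<And>i. v i = 0" for u v S
  proof (cases "S \<subseteq> {1..2*k}")
    case True
    then have "finite S" "card S \<le> 2 * k"
      using finite_subset[of S] card_mono[of "{1..2*k}" S] by auto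
    then show ?thesis using f uv by (intro poly_eval_eq_0) auto
  next
    case False
    then show ?thesis using poly_eval_carrier[OF assms, of v u k f] uv by (auto simp: grass_carrier_def)
  qed
  then show "f \<in> IdPgr (grassmann_trivial k) n" using f by (auto simp: IdPgr_def fun_eq_iff)
qed

lemma CPgr_grassmann:
  assumes "1 \<le> n"
  shows "CPgr (grassmann_trivial k :: (nat set, 'a::field_char_0) superalg) n =
    {f \<in> Pgr n. \<forall>I. I \<subseteq> {1..n} \<longrightarrow> odd (card I) \<longrightarrow> card I < 2 * k \<longrightarrow> sgn_form n f I = 0}"
proof (intro equalityI subsetI)
  fix f :: "(nat \<Rightarrow> nat) \<times> nat set \<Rightarrow> 'a"
  assume f: "f \<in> CPgr (grassmann_trivial k) n"
  have "sgn_form n f I = 0" if "I \<subseteq> {1..n}" "odd (card I)" "card I < 2 * k" for I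
  proof -
    obtain u where "\<And>i. u i \<in> grass_carrier k"
      "poly_eval (grassmann_trivial k) n f u (\<lambda>_. 0) {1..card I} = 0 \<Longrightarrow> sgn_form n f I = 0"
      using poly_eval_test[of I n k f] \<open>I \<subseteq> {1..n}\<close> \<open>card I < 2 * k\<close> by (metis less_imp_le)
    then show ?thesis using f \<open>odd (card I)\<close> by (simp add: CPgr_def sa_center_grassmann)
  qed
  then show "f \<in> {f \<in> Pgr n. \<forall>I. I \<subseteq> {1..n} \<longrightarrow> odd (card I) \<longrightarrow> card I < 2 * k \<longrightarrow> sgn_form n f I = 0}"
    using f by (auto simp: CPgr_def)
next
  fix f :: "(nat \<Rightarrow> nat) \<times> nat set \<Rightarrow> 'a"
  assume f: "f \<in> {f \<in> Pgr n. \<forall>I. I \<subseteq> {1..n} \<longrightarrow> odd (card I) \<longrightarrow> card I < 2 * k \<longrightarrow> sgn_form n f I = 0}"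
  have "poly_eval (grassmann_trivial k) n f u v \<in> sa_center (grassmann_trivial k)"
    if uv: "\<And>i. u i \<in> grass_carrier k" "\<And>i. v i = 0" for u v
  proof -
    have car: "poly_eval (grassmann_trivial k) n f u v \<in> grass_carrier k"
      using poly_eval_carrier[OF assms uv(2,1)] .
    have "poly_eval (grassmann_trivial k) n f u v S = 0" if S: "odd (card S)" for S
    proof (cases "S \<subseteq> {1..2*k}")
      case True
      then have "finite S" "card S \<le> 2 * k"
        using finite_subset[of S] card_mono[of "{1..2*k}" S] by auto
      moreover have "card S \<noteq> 2 * k" using S by auto
      ultimately show ?thesis using f uv S by (intro poly_eval_eq_0) auto
    next
      case False
      then show ?thesis using car by (auto simp: grass_carrier_def)
    qed
    then show ?thesis using car by (simp add: sa_center_grassmann)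
  qed
  then show "f \<in> CPgr (grassmann_trivial k) n" using f by (auto simp: CPgr_def)
qed

section \<open>The exterior algebra of the permutation module\<close>

text \<open>The exterior algebra of \<open>F\<^sup>n\<close> is represented by coefficient functions on subsets of \<open>{1..n}\<close>,
  cut down to the degrees in \<open>D\<close>. On it \<open>ext_act\<close> is the action induced by permuting the basis, and
  \<open>wedge_s\<close> is left multiplication by \<open>e\<^sub>1 + \<dots> + e\<^sub>n\<close>.\<close>

definition ext_basis :: "nat \<Rightarrow> nat set \<Rightarrow> nat set set" where
  "ext_basis n D = {I. I \<subseteq> {1..n} \<and> card I \<in> D}"

abbreviation ext_space :: "nat \<Rightarrow> nat set \<Rightarrow> (nat set \<Rightarrow> 'a::zero) set" where
  "ext_space n D \<equiv> fsupp (ext_basis n D)"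

definition ext_act :: "(nat \<Rightarrow> nat) \<Rightarrow> (nat set \<Rightarrow> 'a::comm_ring_1) \<Rightarrow> nat set \<Rightarrow> 'a" where
  "ext_act \<sigma> \<omega> = (\<lambda>I. inv_sign (inv \<sigma>) I * \<omega> (inv \<sigma> ` I))"

text \<open>For i in \<open>I\<close> this is the sign between e_i \<and> e_(I - {i}) and e_I: e_i
  moves past the smaller elements of \<open>I\<close>.\<close>

definition pos_sign :: "nat \<Rightarrow> nat set \<Rightarrow> 'a::comm_ring_1" where
  "pos_sign i I = (\<Prod>x\<in>I. if x < i then -1 else 1)"

definition wedge_s :: "nat \<Rightarrow> (nat set \<Rightarrow> 'a::comm_ring_1) \<Rightarrow> nat set \<Rightarrow> 'a" where
  "wedge_s n \<omega> = (\<lambda>I. if I \<subseteq> {1..n} then \<Sum>i\<in>I. pos_sign i I * \<omega> (I - {i}) else 0)"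

definition contract_1 :: "nat \<Rightarrow> (nat set \<Rightarrow> 'a::comm_ring_1) \<Rightarrow> nat set \<Rightarrow> 'a" where
  "contract_1 n \<omega> = (\<lambda>I. if I \<subseteq> {1..n} \<and> 1 \<notin> I then \<omega> (insert 1 I) else 0)"

lemma finite_ext_basis [simp]: "finite (ext_basis n D)"
  by (rule finite_subset[of _ "Pow {1..n}"]) (auto simp: ext_basis_def)

lemma flinear_ext_act: "flinear (ext_act \<sigma>)"
  by (rule flinearI) (auto simp: ext_act_def fun_eq_iff algebra_simps)

lemma flinear_wedge_s: "flinear (wedge_s n)"
  by (rule flinearI) (auto simp: wedge_s_def fun_eq_iff algebra_simps sum.distrib sum_distrib_left)

lemma permutes_image_subset_iff:
  assumes "\<sigma> permutes S"
  shows "\<sigma> ` I \<subseteq> S \<longleftrightarrow> I \<subseteq> S"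
  using permutes_in_image[OF assms] by blast

lemma permutes_card_image: "\<sigma> permutes S \<Longrightarrow> card (\<sigma> ` I) = card I"
  by (rule card_image) (auto intro: permutes_inj_on)

lemma permutes_ext_basis_iff:
  "\<sigma> permutes {1..n} \<Longrightarrow> \<sigma> ` I \<in> ext_basis n D \<longleftrightarrow> I \<in> ext_basis n D"
  by (simp add: ext_basis_def permutes_image_subset_iff permutes_card_image)

lemma ext_act_in_ext_space:
  assumes "\<sigma> permutes {1..n}" "\<omega> \<in> ext_space n D"
  shows "ext_act \<sigma> \<omega> \<in> ext_space n D"
  using assms by (auto simp: fsupp_def ext_act_def permutes_ext_basis_iff permutes_inv)

lemma pos_sign_remove:
  assumes "finite I" "i \<in> I" "i \<noteq> j"
  shows "pos_sign j I = (if i < j then -1 else 1) * pos_sign j (I - {i})"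
  using assms by (simp add: pos_sign_def prod.remove)

text \<open>Expanding \<open>\<rho> e\<^sub>I\<close> after moving \<open>e\<^sub>i\<close> to the front, before or after applying \<open>\<rho>\<close>.\<close>

lemma pos_sign_inv_sign:
  assumes "finite I" "i \<in> I" "inj \<rho>"
  shows "pos_sign i I * inv_sign \<rho> (I - {i}) = (inv_sign \<rho> I * pos_sign (\<rho> i) (\<rho> ` I) :: 'a::comm_ring_1)"
proof -
  let ?J = "I - {i}"
  have I: "I = insert i ?J" "finite ?J" "i \<notin> ?J" using assms by auto
  have 1: "pos_sign i I = (\<Prod>x\<in>?J. if x < i then -1 else 1 :: 'a)"
    unfolding pos_sign_def using assms by (subst prod.remove[of _ i]) auto
  have "pos_sign (\<rho> i) (\<rho> ` I) = (\<Prod>x\<in>I. if \<rho> x < \<rho> i then -1 else 1 :: 'a)"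
    unfolding pos_sign_def using assms(3) by (subst prod.reindex) (auto intro: inj_on_subset)
  also have "\<dots> = (\<Prod>x\<in>?J. if \<rho> x < \<rho> i then -1 else 1)"
    using assms by (subst prod.remove[of _ i]) auto
  finally have 2: "pos_sign (\<rho> i) (\<rho> ` I) = (\<Prod>x\<in>?J. if \<rho> x < \<rho> i then -1 else 1 :: 'a)" .
  have 3: "inv_sign \<rho> I = (\<Prod>x\<in>?J. cross_sign \<rho> i x) * (inv_sign \<rho> ?J :: 'a)"
    using inv_sign_insert[OF I(2,3), of \<rho>] I(1) by simp
  have "(\<Prod>x\<in>?J. if x < i then -1 else 1 :: 'a) =
      (\<Prod>x\<in>?J. cross_sign \<rho> i x * (if \<rho> x < \<rho> i then -1 else 1))"
  proof (rule prod.cong[OF refl])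
    fix x assume "x \<in> ?J"
    then have "x \<noteq> i" "\<rho> x \<noteq> \<rho> i" using assms(3) by (auto simp: inj_eq)
    then show "(if x < i then -1 else 1 :: 'a) = cross_sign \<rho> i x * (if \<rho> x < \<rho> i then -1 else 1)"
      by (auto simp: cross_sign_def)
  qed
  then show ?thesis unfolding 1 2 3 by (simp add: prod.distrib algebra_simps)
qed

text \<open>The vector s is fixed by every permutation of the basis. In coordinates
  \<open>pos_sign_inv_sign\<close> carries the summand at i to the summand at
  \<open>\<rho> i\<close>, where \<open>\<rho>\<close> is \<open>inv \<sigma>\<close>.\<close>

lemma wedge_s_ext_act:
  fixes \<omega> :: "nat set \<Rightarrow> 'a::comm_ring_1"
  assumes "\<sigma> permutes {1..n}"
  shows "wedge_s n (ext_act \<sigma> \<omega>) = ext_act \<sigma> (wedge_s n \<omega>)"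
proof
  fix I
  define \<rho> where "\<rho> = inv \<sigma>"
  have \<rho>: "\<rho> permutes {1..n}" using assms by (simp add: \<rho>_def permutes_inv)
  have inj: "inj \<rho>" using \<rho> by (rule permutes_inj)
  show "wedge_s n (ext_act \<sigma> \<omega>) I = ext_act \<sigma> (wedge_s n \<omega>) I"
  proof (cases "I \<subseteq> {1..n}")
    case True
    then have fin: "finite I" using finite_subset by blast
    have sub: "\<rho> ` I \<subseteq> {1..n}" using True permutes_image_subset_iff[OF \<rho>] by simp
    have "wedge_s n (ext_act \<sigma> \<omega>) I = (\<Sum>i\<in>I. pos_sign i I * inv_sign \<rho> (I - {i}) * \<omega> (\<rho> ` (I - {i})))"
      using True by (simp add: wedge_s_def ext_act_def \<rho>_def mult.assoc)
    also have "\<dots> = (\<Sum>i\<in>I. inv_sign \<rho> I * pos_sign (\<rho> i) (\<rho> ` I) * \<omega> (\<rho> ` I - {\<rho> i}))"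
      using fin inj by (intro sum.cong) (auto simp: pos_sign_inv_sign image_set_diff)
    also have "\<dots> = (\<Sum>j\<in>\<rho> ` I. inv_sign \<rho> I * pos_sign j (\<rho> ` I) * \<omega> (\<rho> ` I - {j}))"
      using inj by (subst sum.reindex) (auto intro: inj_on_subset)
    also have "\<dots> = ext_act \<sigma> (wedge_s n \<omega>) I"
      using sub by (simp add: wedge_s_def ext_act_def flip: \<rho>_def) (simp add: sum_distrib_left mult.assoc)
    finally show ?thesis .
  next
    case False
    then have "\<not> \<rho> ` I \<subseteq> {1..n}" using permutes_image_subset_iff[OF \<rho>] by simp
    then show ?thesis using False by (simp add: wedge_s_def ext_act_def flip: \<rho>_def)
  qed
qed

lemma wedge_s_in_ext_space:
  assumes "\<omega> \<in> ext_space n D"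
  shows "wedge_s n \<omega> \<in> ext_space n (Suc ` D)"
proof -
  have "wedge_s n \<omega> I = 0" if I: "I \<notin> ext_basis n (Suc ` D)" for I
  proof (cases "I \<subseteq> {1..n}")
    case True
    then have fin: "finite I" using finite_subset by blast
    have "\<omega> (I - {i}) = 0" if "i \<in> I" for i
    proof -
      have "card I = Suc (card (I - {i}))" using fin that by (metis card.remove)
      then have "I - {i} \<notin> ext_basis n D" using I True by (auto simp: ext_basis_def)
      then show ?thesis using assms by (simp add: fsupp_def)
    qed
    then show ?thesis by (simp add: wedge_s_def)
  qed (simp add: wedge_s_def)
  then show ?thesis by (simp add: fsupp_def)
qed

text \<open>This is s \<and> s = 0: the double sum over ordered pairs (i, j) is antisymmetric, hence
  equal to its own negative, and 2 is invertible.\<close>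

lemma wedge_s_wedge_s:
  fixes \<omega> :: "nat set \<Rightarrow> 'a::field_char_0"
  shows "wedge_s n (wedge_s n \<omega>) = 0"
proof
  fix I
  show "wedge_s n (wedge_s n \<omega>) I = 0 I"
  proof (cases "I \<subseteq> {1..n}")
    case True
    then have fin: "finite I" using finite_subset by blast
    \<comment> \<open>Both position signs are taken with respect to the full set \<open>I\<close>,
      so that antisymmetry in i and j becomes visible.\<close>
    define F where "F i j = (if i = j then 0 else pos_sign i I * pos_sign j I *
      (if i < j then -1 else 1) * \<omega> (I - {i, j}))" for i j
    have "wedge_s n (wedge_s n \<omega>) I =
        (\<Sum>i\<in>I. \<Sum>j\<in>I - {i}. pos_sign i I * (pos_sign j (I - {i}) * \<omega> (I - {i} - {j})))"
      using True by (auto simp: wedge_s_def sum_distrib_left intro!: sum.cong)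
    also have "\<dots> = (\<Sum>i\<in>I. \<Sum>j\<in>I - {i}. F i j)"
      using fin by (intro sum.cong) (auto simp: F_def pos_sign_remove[of I _ _, OF fin] insert_commute
          simp flip: Diff_insert2)
    also have "\<dots> = (\<Sum>i\<in>I. \<Sum>j\<in>I. F i j)"
      using fin by (intro sum.cong sum.mono_neutral_left) (auto simp: F_def)
    finally have eq: "wedge_s n (wedge_s n \<omega>) I = (\<Sum>i\<in>I. \<Sum>j\<in>I. F i j)" .
    have "(\<Sum>i\<in>I. \<Sum>j\<in>I. F i j) = (\<Sum>i\<in>I. \<Sum>j\<in>I. F j i)" by (rule sum.swap)
    also have "\<dots> = - (\<Sum>i\<in>I. \<Sum>j\<in>I. F i j)"
      unfolding sum_negf[symmetric]
      by (intro sum.cong) (auto simp: F_def insert_commute mult.commute)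
    finally show ?thesis using eq by simp
  qed (simp add: wedge_s_def)
qed

text \<open>Contraction with the first coordinate functional is a contracting homotopy.\<close>

lemma wedge_s_contract_1:
  fixes \<omega> :: "nat set \<Rightarrow> 'a::comm_ring_1"
  assumes "1 \<le> n" "I \<subseteq> {1..n}"
  shows "wedge_s n (contract_1 n \<omega>) I + contract_1 n (wedge_s n \<omega>) I = \<omega> I"
proof -
  have fin: "finite I" using assms(2) finite_subset by blast
  have ps1: "pos_sign 1 J = (1 :: 'a)" if "J \<subseteq> {1..n}" for J
    using that unfolding pos_sign_def by (intro prod.neutral) auto
  show ?thesis
  proof (cases "1 \<in> I")
    case True
    \<comment> \<open>For i other than 1 the set \<open>I - {i}\<close> still contains 1, where a
      contracted form vanishes.\<close>
    have "wedge_s n (contract_1 n \<omega>) I = (\<Sum>i\<in>I. if i = 1 then \<omega> I else 0)"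
      using assms(2) True ps1[OF assms(2)] unfolding wedge_s_def
      by (auto simp: contract_1_def insert_absorb intro!: sum.cong)
    then show ?thesis using True fin by (simp add: contract_1_def)
  next
    case False
    have sub: "insert 1 I \<subseteq> {1..n}" using assms by auto
    have "wedge_s n \<omega> (insert 1 I) =
        pos_sign 1 (insert 1 I) * \<omega> (insert 1 I - {1}) + (\<Sum>i\<in>I. pos_sign i (insert 1 I) * \<omega> (insert 1 I - {i}))"
      using sub fin False by (simp add: wedge_s_def)
    also have "insert 1 I - {1} = I" using False by auto
    also have "(\<Sum>i\<in>I. pos_sign i (insert 1 I) * \<omega> (insert 1 I - {i})) =
        (\<Sum>i\<in>I. - (pos_sign i I * \<omega> (insert 1 (I - {i}))))"
    proof (rule sum.cong[OF refl])
      fix i assume i: "i \<in> I"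
      then have "1 < i" using assms(2) False by (metis atLeastAtMost_iff le_neq_implies_less subsetD)
      then show "pos_sign i (insert 1 I) * \<omega> (insert 1 I - {i}) = - (pos_sign i I * \<omega> (insert 1 (I - {i})))"
        using fin False by (simp add: pos_sign_def insert_Diff_if)
    qed
    also have "\<dots> = - wedge_s n (contract_1 n \<omega>) I"
      using assms(2) False by (auto simp: wedge_s_def contract_1_def sum_negf intro!: sum.cong)
    finally show ?thesis
      using False assms(2) ps1[OF sub] by (simp add: contract_1_def)
  qed
qed

lemma contract_1_in_ext_space:
  assumes "\<omega> \<in> ext_space n (Suc ` D)"
  shows "contract_1 n \<omega> \<in> ext_space n D"
proof -
  have "\<omega> (insert 1 I) = 0" if "I \<subseteq> {1..n}" "1 \<notin> I" "I \<notin> ext_basis n D" for I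
  proof -
    have "card (insert 1 I) = Suc (card I)" using that finite_subset[of I "{1..n}"] by simp
    then have "insert 1 I \<notin> ext_basis n (Suc ` D)" using that by (auto simp: ext_basis_def)
    then show ?thesis using assms by (simp add: fsupp_def)
  qed
  then show ?thesis by (auto simp: fsupp_def contract_1_def)
qed

lemma wedge_s_zero [simp]: "wedge_s n 0 = 0"
  by (auto simp: wedge_s_def)

text \<open>By the homotopy, a form annihilated by s is s times its own contraction; the converse is
  s \<and> s = 0.\<close>

lemma wedge_s_kernel_Suc:
  assumes "1 \<le> n"
  shows "{\<omega> \<in> ext_space n {Suc j}. wedge_s n \<omega> = 0} =
    (wedge_s n ` ext_space n {j} :: (nat set \<Rightarrow> 'a::field_char_0) set)"
proof (intro equalityI subsetI)
  fix \<omega> :: "nat set \<Rightarrow> 'a"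
  assume "\<omega> \<in> {\<omega> \<in> ext_space n {Suc j}. wedge_s n \<omega> = 0}"
  then have \<omega>: "\<omega> \<in> ext_space n {Suc j}" "wedge_s n \<omega> = 0" by auto
  have "\<omega> I = wedge_s n (contract_1 n \<omega>) I" for I
  proof (cases "I \<subseteq> {1..n}")
    case True
    then show ?thesis
      using wedge_s_contract_1[OF assms True, of \<omega>] \<omega>(2) by (simp add: contract_1_def[of n 0] split: if_splits)
  next
    case False
    then show ?thesis using \<omega>(1) by (auto simp: wedge_s_def fsupp_def ext_basis_def)
  qed
  moreover have "contract_1 n \<omega> \<in> ext_space n {j}"
    using contract_1_in_ext_space[of \<omega> n "{j}"] \<omega>(1) by simp
  ultimately show "\<omega> \<in> wedge_s n ` ext_space n {j}" by (intro image_eqI[of _ _ "contract_1 n \<omega>"] ext)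
next
  fix \<omega> :: "nat set \<Rightarrow> 'a"
  assume "\<omega> \<in> wedge_s n ` ext_space n {j}"
  then show "\<omega> \<in> {\<omega> \<in> ext_space n {Suc j}. wedge_s n \<omega> = 0}"
    using wedge_s_in_ext_space[of _ n "{j}"] by (auto simp: wedge_s_wedge_s)
qed

text \<open>The left end of the exact sequence: s times a scalar c has coefficient c at e_1, an
  index available because 1 \<le> n.\<close>

lemma wedge_s_kernel_0:
  assumes "1 \<le> n"
  shows "{\<omega> \<in> ext_space n {0}. wedge_s n \<omega> = 0} = {0 :: nat set \<Rightarrow> 'a::comm_ring_1}"
proof (intro equalityI subsetI)
  fix \<omega> :: "nat set \<Rightarrow> 'a"
  assume "\<omega> \<in> {\<omega> \<in> ext_space n {0}. wedge_s n \<omega> = 0}"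
  then have \<omega>: "\<omega> \<in> ext_space n {0}" "wedge_s n \<omega> = 0" by auto
  have "wedge_s n \<omega> {1} = \<omega> {}" using assms by (simp add: wedge_s_def pos_sign_def)
  then have "\<omega> {} = 0" using \<omega>(2) by simp
  moreover have "\<omega> I = 0" if "I \<noteq> {}" for I
  proof -
    have "I \<notin> ext_basis n {0}" using that finite_subset[of I "{1..n}"] by (auto simp: ext_basis_def)
    then show ?thesis using \<omega>(1) by (simp add: fsupp_def)
  qed
  ultimately show "\<omega> \<in> {0}" by (auto simp: fun_eq_iff) metis
qed (auto simp: fsupp_def)

text \<open>In increasing order of i the summands are 1, -1, 1, ..., and a new maximum appends the
  next one.\<close>

lemma sum_pos_sign:
  "finite I \<Longrightarrow> (\<Sum>i\<in>I. pos_sign i I) = (if odd (card I) then 1 else 0 :: 'a::comm_ring_1)"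
proof (induction I rule: finite_linorder_max_induct)
  case (insert b A)
  have "b \<notin> A" using insert by auto
  have "pos_sign i (insert b A) = (pos_sign i A :: 'a)" if "i \<in> A" for i
    using insert.hyps \<open>b \<notin> A\<close> that by (auto simp: pos_sign_def dest: order.asym)
  moreover have "pos_sign b (insert b A) = ((-1) ^ card A :: 'a)"
    using insert \<open>b \<notin> A\<close> by (simp add: pos_sign_def)
  ultimately show ?case using insert \<open>b \<notin> A\<close> by simp
qed simp

text \<open>Glue a bijection from \<open>A\<close> to \<open>B\<close> with one between the
  complements. This transitivity lets a single basis vector reach all others of its degree.\<close>

lemma ex_permutes_image:
  assumes "finite S" "A \<subseteq> S" "B \<subseteq> S" "card A = card B"
  obtains \<rho> where "\<rho> permutes S" "\<rho> ` A = B"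
proof -
  have fin: "finite A" "finite B" using assms finite_subset by blast+
  obtain f where f: "bij_betw f A B"
    using assms(4) fin finite_same_card_bij by blast
  have "card (S - A) = card (S - B)" using assms fin by (simp add: card_Diff_subset)
  then obtain g where g: "bij_betw g (S - A) (S - B)"
    using assms(1) finite_same_card_bij by blast
  define \<rho> where "\<rho> x = (if x \<in> A then f x else if x \<in> S then g x else x)" for x
  have "bij_betw \<rho> A B" using f by (rule bij_betw_cong[THEN iffD1, rotated]) (simp add: \<rho>_def)
  moreover have "bij_betw \<rho> (S - A) (S - B)"
    using g by (rule bij_betw_cong[THEN iffD1, rotated]) (simp add: \<rho>_def)
  ultimately have "bij_betw \<rho> (A \<union> (S - A)) (B \<union> (S - B))"
    by (rule bij_betw_combine) auto
  then have "bij_betw \<rho> S S" using assms by (simp add: Un_absorb1)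
  then have "\<rho> permutes S" using assms by (intro bij_imp_permutes) (auto simp: \<rho>_def)
  then show thesis using that \<open>bij_betw \<rho> A B\<close> bij_betw_imp_surj_on by blast
qed

lemma ext_act_fsingle:
  assumes "\<rho> permutes S"
  shows "fsingle (\<rho> ` B) = fsc (inv_sign (inv \<rho>) (\<rho> ` B)) (ext_act \<rho> (fsingle B) :: nat set \<Rightarrow> 'a::field)"
proof
  fix I
  have bij: "bij \<rho>" using assms permutes_bij by blast
  have "inv \<rho> ` I = B \<longleftrightarrow> I = \<rho> ` B"
    using bij by (metis bij_is_inj bij_is_surj image_inv_f_f image_f_inv_f)
  then show "fsingle (\<rho> ` B) I = fsc (inv_sign (inv \<rho>) (\<rho> ` B)) (ext_act \<rho> (fsingle B)) I"
    by (auto simp: fsingle_def ext_act_def)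
qed

section \<open>Polynomials modulo central polynomials and modulo identities\<close>

definition ext_map ::
    "nat \<Rightarrow> nat set \<Rightarrow> ((nat \<Rightarrow> nat) \<times> nat set \<Rightarrow> 'a::comm_ring_1) \<Rightarrow> nat set \<Rightarrow> 'a" where
  "ext_map n D f = (\<lambda>I. if I \<in> ext_basis n D then sgn_form n f I else 0)"

lemma Pgr_eq_fsupp: "Pgr n = fsupp (gr_monos n)"
  by (simp add: Pgr_def fsupp_def)

lemma flinear_ext_map: "flinear (ext_map n D)"
  by (rule flinearI)
    (auto simp: ext_map_def sgn_form_def fun_eq_iff algebra_simps sum.distrib sum_distrib_left)

lemma flinear_wr_act: "flinear (wr_act n g)"
  by (rule flinearI) (auto simp: wr_act_def fun_eq_iff algebra_simps split: prod.splits)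

lemma wr_act_in_Pgr: "wr_act n g f \<in> Pgr n"
  by (auto simp: wr_act_def Pgr_def split: prod.splits)

lemma wr_act_id: "f \<in> Pgr n \<Longrightarrow> wr_act n ({}, id) f = f"
  by (auto simp: wr_act_def Pgr_def fun_eq_iff)

lemma ext_act_id: "ext_act id \<omega> = \<omega>"
  by (simp add: ext_act_def)

lemma ext_map_eq_0_iff: "ext_map n D f = 0 \<longleftrightarrow> (\<forall>I\<in>ext_basis n D. sgn_form n f I = 0)"
  by (auto simp: ext_map_def fun_eq_iff)

text \<open>Only monomials without odd variables are seen, so the sign part \<open>N\<close> acts
  trivially. The rest is multiplicativity of inversion signs after reindexing by left multiplication
  with \<open>inv \<sigma>\<close>.\<close>

lemma ext_map_wr_act:
  fixes f :: "(nat \<Rightarrow> nat) \<times> nat set \<Rightarrow> 'a::comm_ring_1"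
  assumes \<sigma>: "\<sigma> permutes {1..n}"
  shows "ext_map n D (wr_act n (N, \<sigma>) f) = ext_act \<sigma> (ext_map n D f)"
proof
  fix I
  have inv\<sigma>: "inv \<sigma> permutes {1..n}" using \<sigma> by (rule permutes_inv)
  show "ext_map n D (wr_act n (N, \<sigma>) f) I = ext_act \<sigma> (ext_map n D f) I"
  proof (cases "I \<in> ext_basis n D")
    case True
    then have fin: "finite I" using finite_subset by (auto simp: ext_basis_def)
    have "sgn_form n (wr_act n (N, \<sigma>) f) I =
        (\<Sum>\<tau> | \<tau> permutes {1..n}. f (inv \<sigma> \<circ> \<tau>, {}) * inv_sign (inv \<tau>) I)"
      unfolding sgn_form_def by (intro sum.cong) (auto simp: wr_act_def gr_monos_def)
    also have "\<dots> = (\<Sum>\<tau> | \<tau> permutes {1..n}.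
        f (\<tau>, {}) * (inv_sign (inv \<tau>) (inv \<sigma> ` I) * inv_sign (inv \<sigma>) I))"
    proof (rule sum.reindex_bij_witness[where i = "\<lambda>\<tau>. \<sigma> \<circ> \<tau>" and j = "\<lambda>\<tau>. inv \<sigma> \<circ> \<tau>"])
      fix \<tau> assume "\<tau> \<in> {\<tau>. \<tau> permutes {1..n}}"
      then have \<tau>: "\<tau> permutes {1..n}" by simp
      show "\<sigma> \<circ> (inv \<sigma> \<circ> \<tau>) = \<tau>" "inv \<sigma> \<circ> (\<sigma> \<circ> \<tau>) = \<tau>"
        using permutes_inv_o[OF \<sigma>] by (simp_all flip: comp_assoc)
      show "inv \<sigma> \<circ> \<tau> \<in> {\<tau>. \<tau> permutes {1..n}}" "\<sigma> \<circ> \<tau> \<in> {\<tau>. \<tau> permutes {1..n}}"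
        using \<tau> \<sigma> inv\<sigma> by (simp_all add: permutes_compose)
      have "inv (inv \<sigma> \<circ> \<tau>) \<circ> inv \<sigma> = inv \<tau>"
        using permutes_bij[OF \<sigma>] permutes_bij[OF \<tau>] permutes_bij[OF inv\<sigma>] permutes_inv_o[OF \<sigma>]
        by (simp add: o_inv_distrib inv_inv_eq comp_assoc)
      then have "inv_sign (inv \<tau>) I =
          (inv_sign (inv (inv \<sigma> \<circ> \<tau>)) (inv \<sigma> ` I) * inv_sign (inv \<sigma>) I :: 'a)"
        using inv_sign_comp_inj[of I "inv (inv \<sigma> \<circ> \<tau>)" "inv \<sigma>", where 'a='a] fin
          permutes_inj[OF permutes_inv[OF permutes_compose[OF \<tau> inv\<sigma>]]] permutes_inj_on[OF inv\<sigma>]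
        by simp
      then show "f (inv \<sigma> \<circ> \<tau>, {}) * (inv_sign (inv (inv \<sigma> \<circ> \<tau>)) (inv \<sigma> ` I) * inv_sign (inv \<sigma>) I) =
          f (inv \<sigma> \<circ> \<tau>, {}) * inv_sign (inv \<tau>) I"
        by simp
    qed
    also have "\<dots> = inv_sign (inv \<sigma>) I * sgn_form n f (inv \<sigma> ` I)"
      by (simp add: sgn_form_def sum_distrib_left algebra_simps)
    finally show ?thesis
      using True permutes_ext_basis_iff[OF inv\<sigma>, of I D] by (simp add: ext_map_def ext_act_def)
  next
    case False
    then show ?thesis
      using permutes_ext_basis_iff[OF inv\<sigma>, of I D] by (simp add: ext_map_def ext_act_def)
  qed
qed

text \<open>In odd degree \<open>2j + 1\<close> the functional is obtained from degree \<open>2j\<close> because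
  \<open>s \<and> \<Sum>\<^bsub>|J| = 2j\<^esub> e\<^sub>J = \<Sum>\<^bsub>|I| = 2j + 1\<^esub> e\<^sub>I\<close>, an alternating sum with an odd number of terms.\<close>

lemma ext_map_Suc:
  fixes f :: "(nat \<Rightarrow> nat) \<times> nat set \<Rightarrow> 'a::comm_ring_1"
  assumes "\<And>j. j \<in> D \<Longrightarrow> even j"
  shows "ext_map n (Suc ` D) f = wedge_s n (ext_map n D f)"
proof
  fix I
  show "ext_map n (Suc ` D) f I = wedge_s n (ext_map n D f) I"
  proof (cases "I \<in> ext_basis n (Suc ` D)")
    case True
    then obtain j where I: "I \<subseteq> {1..n}" "card I = Suc j" "j \<in> D" by (auto simp: ext_basis_def)
    then have fin: "finite I" using finite_subset by blast
    have "I - {i} \<in> ext_basis n D" if "i \<in> I" for i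
      using that I fin by (auto simp: ext_basis_def)
    then have "wedge_s n (ext_map n D f) I = (\<Sum>i\<in>I. pos_sign i I * sgn_form n f (I - {i}))"
      using I by (auto simp: wedge_s_def ext_map_def intro!: sum.cong)
    also have "\<dots> = (\<Sum>\<sigma> | \<sigma> permutes {1..n}. \<Sum>i\<in>I. f (\<sigma>, {}) * (pos_sign i I * inv_sign (inv \<sigma>) (I - {i})))"
      unfolding sgn_form_def sum_distrib_left by (subst sum.swap) (simp add: algebra_simps)
    also have "\<dots> = (\<Sum>\<sigma> | \<sigma> permutes {1..n}. f (\<sigma>, {}) * inv_sign (inv \<sigma>) I)"
    proof (rule sum.cong[OF refl])
      fix \<sigma> assume "\<sigma> \<in> {\<sigma>. \<sigma> permutes {1..n}}"
      then have \<rho>: "inv \<sigma> permutes {1..n}" by (simp add: permutes_inv)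
      have "(\<Sum>i\<in>I. pos_sign i I * inv_sign (inv \<sigma>) (I - {i})) =
          (\<Sum>i\<in>I. inv_sign (inv \<sigma>) I * pos_sign (inv \<sigma> i) (inv \<sigma> ` I) :: 'a)"
        using fin permutes_inj[OF \<rho>] by (intro sum.cong pos_sign_inv_sign) auto
      also have "\<dots> = inv_sign (inv \<sigma>) I * (\<Sum>i\<in>inv \<sigma> ` I. pos_sign i (inv \<sigma> ` I))"
        using permutes_inj_on[OF \<rho>, of I] by (simp add: sum.reindex sum_distrib_left)
      also have "\<dots> = inv_sign (inv \<sigma>) I"
        using fin I assms by (simp add: sum_pos_sign permutes_card_image[OF \<rho>])
      finally show "(\<Sum>i\<in>I. f (\<sigma>, {}) * (pos_sign i I * inv_sign (inv \<sigma>) (I - {i}))) =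
          f (\<sigma>, {}) * inv_sign (inv \<sigma>) I"
        by (simp flip: sum_distrib_left)
    qed
    finally show ?thesis using True by (simp add: ext_map_def sgn_form_def)
  next
    case False
    have "ext_map n D f \<in> ext_space n D" by (simp add: ext_map_def fsupp_def)
    then show ?thesis
      using False wedge_s_in_ext_space[of "ext_map n D f" n D] by (simp add: fsupp_def ext_map_def)
  qed
qed

text \<open>The image \<open>M\<close> contains every \<open>X m\<close>, the sum of all e_I of
  admissible degree with {1..2m} \<subseteq> I. Its smallest term is e_{1..2m} if 2m is in
  \<open>D\<close>, and the larger terms can be subtracted once they are known to lie in
  \<open>M\<close>. Since all sizes in \<open>D\<close> are even, permuting these vectors then gives
  every e_A.\<close>

lemma ext_map_Pgr:
  fixes n :: nat
  assumes D: "\<And>j. j \<in> D \<Longrightarrow> even j"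
  shows "ext_map n D ` Pgr n = (ext_space n D :: (nat set \<Rightarrow> 'a::field_char_0) set)"
proof
  show "ext_map n D ` Pgr n \<subseteq> (ext_space n D :: (nat set \<Rightarrow> 'a) set)"
    by (auto simp: ext_map_def fsupp_def)
  interpret ext_map: Vector_Spaces.linear fsc fsc "ext_map n D :: _ \<Rightarrow> nat set \<Rightarrow> 'a"
    by (rule flinear_ext_map)
  define M :: "(nat set \<Rightarrow> 'a) set" where "M = ext_map n D ` Pgr n"
  have sub: "fsc.subspace M"
    unfolding M_def Pgr_eq_fsupp by (intro ext_map.subspace_image subspace_fsupp)
  have act: "ext_act \<sigma> \<omega> \<in> M" if "\<omega> \<in> M" "\<sigma> permutes {1..n}" for \<omega> \<sigma>
  proof -
    obtain f where "\<omega> = ext_map n D f" using \<open>\<omega> \<in> M\<close> by (auto simp: M_def)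
    then have "ext_act \<sigma> \<omega> = ext_map n D (wr_act n ({}, \<sigma>) f)"
      by (simp add: ext_map_wr_act[OF that(2)])
    then show ?thesis unfolding M_def using wr_act_in_Pgr by (rule image_eqI)
  qed
  define X :: "nat \<Rightarrow> nat set \<Rightarrow> 'a" where
    "X m = (\<lambda>I. if I \<in> ext_basis n D \<and> {1..2 * m} \<subseteq> I then 1 else 0)" for m
  have X: "X m \<in> M" if "2 * m \<le> n" for m
    using that
  proof (induction m)
    case 0
    \<comment> \<open>The monomial y_1 ... y_n has its variables in natural order, so every L_I
      takes the value 1 on it.\<close>
    have "fsingle (id, {}) \<in> (Pgr n :: ((nat \<Rightarrow> nat) \<times> nat set \<Rightarrow> 'a) set)"
      by (auto simp: Pgr_def fsingle_def gr_monos_def permutes_id)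
    moreover have "sgn_form n (fsingle (id, {})) I = (1 :: 'a)" for I
    proof -
      have "sgn_form n (fsingle (id, {})) I =
          (\<Sum>\<sigma> | \<sigma> permutes {1..n}. if \<sigma> = id then inv_sign (inv \<sigma>) I else 0 :: 'a)"
        unfolding sgn_form_def by (intro sum.cong) (auto simp: fsingle_def)
      then show ?thesis by (simp add: permutes_id)
    qed
    then have "ext_map n D (fsingle (id, {})) = X 0"
      by (auto simp: ext_map_def X_def fun_eq_iff)
    ultimately show ?case unfolding M_def by (metis imageI)
  next
    case (Suc m)
    define \<tau> where "\<tau> = transpose (2 * m + 1) (Suc (2 * m + 1))"
    have \<tau>: "\<tau> permutes {1..n}" unfolding \<tau>_def using Suc.prems by (intro permutes_swap_id) auto
    have [simp]: "inv \<tau> = \<tau>" by (simp add: \<tau>_def)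
    have fix\<tau>: "\<tau> i = i" if "i \<in> {1..2 * m}" for i using that by (auto simp: \<tau>_def transpose_def)
    have sub\<tau>: "{1..2 * m} \<subseteq> \<tau> ` I \<longleftrightarrow> {1..2 * m} \<subseteq> I" for I
    proof -
      have "\<tau> ` {1..2 * m} = {1..2 * m}" using fix\<tau> by force
      then show ?thesis using inj_image_subset_iff[OF permutes_inj[OF \<tau>], of "{1..2*m}" I] by simp
    qed
    \<comment> \<open>Among the I containing {1..2m}, the action of \<open>\<tau>\<close> reproduces
      the coefficient 1 unless both swapped indices lie in I, where it gives -1. The difference is
      therefore 2 or 0.\<close>
    have "X (Suc m) = fsc (1 / 2) (X m - ext_act \<tau> (X m))"
    proof
      fix I
      show "X (Suc m) I = fsc (1 / 2) (X m - ext_act \<tau> (X m)) I"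
      proof (cases "I \<in> ext_basis n D \<and> {1..2 * m} \<subseteq> I")
        case True
        then have fin: "finite I" using finite_subset by (auto simp: ext_basis_def)
        have "{1..2 * Suc m} = insert (2 * m + 1) (insert (Suc (2 * m + 1)) {1..2 * m})" by auto
        then have "{1..2 * Suc m} \<subseteq> I \<longleftrightarrow> 2 * m + 1 \<in> I \<and> Suc (2 * m + 1) \<in> I"
          using True by simp
        moreover have "inv_sign \<tau> I = (if 2 * m + 1 \<in> I \<and> Suc (2 * m + 1) \<in> I then -1 else 1 :: 'a)"
          unfolding \<tau>_def using fin by (auto simp: inv_sign_transpose inv_sign_transpose_Suc)
        ultimately show ?thesis
          using True permutes_ext_basis_iff[OF \<tau>, of I D] sub\<tau>[of I] by (simp add: X_def ext_act_def)
      next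
        case False
        moreover have "{1..2 * m} \<subseteq> {1..2 * Suc m}" by auto
        ultimately have "\<not> (I \<in> ext_basis n D \<and> {1..2 * Suc m} \<subseteq> I)" by blast
        then show ?thesis
          using False permutes_ext_basis_iff[OF \<tau>, of I D] sub\<tau>[of I] by (auto simp: X_def ext_act_def)
      qed
    qed
    moreover have "X m \<in> M" using Suc by simp
    ultimately show ?case
      by (simp only: fsc.subspace_scale[OF sub] fsc.subspace_diff[OF sub] act[OF _ \<tau>])
  qed
  have "fsingle A \<in> M" if "A \<in> ext_basis n D" for A
    using that
  \<comment> \<open>The induction runs downwards in the size of \<open>A\<close>: besides e_{1..2m},
    \<open>X m\<close> involves only larger sets.\<close>
  proof (induction "n - card A" arbitrary: A rule: less_induct)
    case less
    then have A: "A \<subseteq> {1..n}" "card A \<in> D" by (auto simp: ext_basis_def)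
    then obtain m where m: "card A = 2 * m" using D by blast
    have "card A \<le> n" using card_mono[OF _ A(1)] by simp
    then have mn: "2 * m \<le> n" using m by simp
    let ?L = "{I \<in> ext_basis n D. card I > 2 * m}"
    have "fsupp ?L \<subseteq> M"
    proof (rule fsupp_subset_subspaceI[OF _ sub])
      fix I assume I: "I \<in> ?L"
      then have "card I \<le> n" using card_mono[of "{1..n}" I] by (simp add: ext_basis_def)
      then show "fsingle I \<in> M" using I m by (intro less.hyps) auto
    qed simp
    moreover have "X m - fsingle {1..2 * m} \<in> fsupp ?L"
    proof -
      have "(X m - fsingle {1..2 * m}) I = 0" if I: "I \<notin> ?L" for I
      proof (cases "I \<in> ext_basis n D \<and> {1..2 * m} \<subseteq> I")
        case True
        then have "finite I" "card I \<le> 2 * m" using I finite_subset by (auto simp: ext_basis_def)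
        then have "I = {1..2 * m}" using True card_seteq[of I "{1..2 * m}"] by simp
        then show ?thesis using True by (simp add: X_def fsingle_def)
      next
        case False
        moreover have "{1..2 * m} \<in> ext_basis n D" using mn m A by (auto simp: ext_basis_def)
        ultimately show ?thesis by (auto simp: X_def fsingle_def)
      qed
      then show ?thesis by (simp add: fsupp_def)
    qed
    ultimately have "X m - fsingle {1..2 * m} \<in> M" by blast
    then have "X m - (X m - fsingle {1..2 * m}) \<in> M"
      by (rule fsc.subspace_diff[OF sub X[OF mn]])
    then have 1: "fsingle {1..2 * m} \<in> M" by simp
    obtain \<rho> where \<rho>: "\<rho> permutes {1..n}" "\<rho> ` {1..2 * m} = A"
      using ex_permutes_image[of "{1..n}" "{1..2 * m}" A] A m mn by auto
    show ?case
      using ext_act_fsingle[OF \<rho>(1), of "{1..2 * m}", where 'a='a]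
      by (simp only: \<rho>(2) fsc.subspace_scale[OF sub act[OF 1 \<rho>(1)]])
  qed
  then show "ext_space n D \<subseteq> ext_map n D ` (Pgr n :: ((nat \<Rightarrow> nat) \<times> nat set \<Rightarrow> 'a) set)"
    using fsupp_subset_subspaceI[OF finite_ext_basis sub] unfolding M_def by blast
qed

section \<open>Specht modules of hooks\<close>

text \<open>For j < n these are the entries of the first column in the row-reading tableau: 1 in the
  corner, then n - j + 1, ..., n below it.\<close>

definition hook_column :: "nat \<Rightarrow> nat \<Rightarrow> nat set" where
  "hook_column n j = insert 1 {n - j + 1..n}"

text \<open>An alternating form \<open>\<omega>\<close> of degree \<open>j + 1\<close> becomes the function sending \<open>\<pi>\<close> to the value of \<open>\<omega>\<close>
  on the image under \<open>\<pi>\<close> of the first column of the hook. The Specht module turns out to be the image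
  of the multiples of \<open>e\<^sub>1 + \<dots> + e\<^sub>n\<close>.\<close>

definition hook_map :: "nat \<Rightarrow> nat \<Rightarrow> (nat set \<Rightarrow> 'a::comm_ring_1) \<Rightarrow> (nat \<Rightarrow> nat) \<Rightarrow> 'a" where
  "hook_map n j \<omega> = (\<lambda>\<pi>. if \<pi> permutes {1..n}
     then inv_sign \<pi> (hook_column n j) * \<omega> (\<pi> ` hook_column n j) else 0)"

lemma flinear_hook_map: "flinear (hook_map n j)"
  by (rule flinearI) (auto simp: hook_map_def fun_eq_iff algebra_simps)

lemma finite_hook_column [simp]: "finite (hook_column n j)"
  by (simp add: hook_column_def)

lemma hook_column_subset: "j < n \<Longrightarrow> hook_column n j \<subseteq> {1..n}"
  by (auto simp: hook_column_def)

lemma card_hook_column: "j < n \<Longrightarrow> card (hook_column n j) = Suc j"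
  by (simp add: hook_column_def)

text \<open>For j \<ge> n the truncated difference n - j makes the first part 0, so
  \<open>specht_char\<close> takes its default value 0 there.\<close>

lemma is_partition_hook: "is_partition n (hook n j) \<longleftrightarrow> j < n"
proof -
  have "sorted_wrt (\<ge>) (replicate j (1::nat))" by (induction j) auto
  then show ?thesis by (auto simp: is_partition_def hook_def sum_list_replicate)
qed

section \<open>Row group, column group and Young symmetrizer of a hook\<close>

lemma cells_hook:
  assumes "j < n"
  shows "cells (hook n j) = {0} \<times> {..<n - j} \<union> {1..j} \<times> {0}"
  using assms unfolding cells_def hook_def
  by (auto simp: nth_Cons' less_Suc_eq_le split: if_splits)

lemma tab_hook_0: "tab (hook n j) (0, c) = c + 1"
  by (simp add: tab_def)

lemma tab_hook_pos:
  assumes "j < n" "1 \<le> r" "r \<le> j"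
  shows "tab (hook n j) (r, 0) = n - j + r"
proof -
  obtain r' where "r = Suc r'" using assms by (cases r) auto
  then show ?thesis using assms by (simp add: tab_def hook_def sum_list_replicate min_def)
qed

text \<open>Every row below the first consists of one cell, whose entry must be fixed.\<close>

lemma row_group_hook:
  assumes "j < n"
  shows "row_group (hook n j) n = {p. p permutes {1..n - j}}"
proof (intro equalityI subsetI)
  fix p assume "p \<in> row_group (hook n j) n"
  then have p: "p permutes {1..n}" and
    *: "\<And>r c. (r, c) \<in> cells (hook n j) \<Longrightarrow>
      \<exists>c'. (r, c') \<in> cells (hook n j) \<and> p (tab (hook n j) (r, c)) = tab (hook n j) (r, c')"
    by (auto simp: row_group_def)
  have "p x = x" if "x \<in> {1..n} - {1..n - j}" for x
  proof -
    define r where "r = x - (n - j)"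
    have r: "1 \<le> r" "r \<le> j" "x = n - j + r" using that by (auto simp: r_def)
    then obtain c' where c': "(r, c') \<in> cells (hook n j)" "p (tab (hook n j) (r, 0)) = tab (hook n j) (r, c')"
      using *[of r 0] assms by (auto simp: cells_hook)
    then have "c' = 0" using r assms by (auto simp: cells_hook)
    then show ?thesis using c' r assms by (simp add: tab_hook_pos)
  qed
  then show "p \<in> {p. p permutes {1..n - j}}" using p permutes_superset by blast
next
  fix p assume "p \<in> {p. p permutes {1..n - j}}"
  then have p: "p permutes {1..n - j}" by simp
  have "\<exists>c'. (r, c') \<in> cells (hook n j) \<and> p (tab (hook n j) (r, c)) = tab (hook n j) (r, c')"
    if rc: "(r, c) \<in> cells (hook n j)" for r c
  proof (cases "r = 0")
    case True
    then have "c + 1 \<in> {1..n - j}" using rc assms by (auto simp: cells_hook)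
    then have "p (c + 1) \<in> {1..n - j}" using permutes_in_image[OF p] by blast
    then show ?thesis using True assms
      by (intro exI[of _ "p (c + 1) - 1"]) (auto simp: cells_hook tab_hook_0)
  next
    case False
    then have r: "1 \<le> r" "r \<le> j" "c = 0" using rc assms by (auto simp: cells_hook)
    then have "p (n - j + r) = n - j + r" using permutes_not_in[OF p] by simp
    then show ?thesis using r rc assms by (intro exI[of _ 0]) (simp add: tab_hook_pos)
  qed
  then show "p \<in> row_group (hook n j) n"
    using permutes_subset[OF p, of "{1..n}"] by (auto simp: row_group_def)
qed

text \<open>Every column after the first consists of one cell, whose entry must be fixed.\<close>

lemma col_group_hook:
  assumes "j < n"
  shows "col_group (hook n j) n = {q. q permutes hook_column n j}"
proof (intro equalityI subsetI)
  fix q assume "q \<in> col_group (hook n j) n"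
  then have q: "q permutes {1..n}" and
    *: "\<And>r c. (r, c) \<in> cells (hook n j) \<Longrightarrow>
      \<exists>r'. (r', c) \<in> cells (hook n j) \<and> q (tab (hook n j) (r, c)) = tab (hook n j) (r', c)"
    by (auto simp: col_group_def)
  have "q x = x" if "x \<in> {1..n} - hook_column n j" for x
  proof -
    have x: "2 \<le> x" "x \<le> n - j" using that by (auto simp: hook_column_def)
    then obtain r' where r': "(r', x - 1) \<in> cells (hook n j)"
      "q (tab (hook n j) (0, x - 1)) = tab (hook n j) (r', x - 1)"
      using *[of 0 "x - 1"] assms by (auto simp: cells_hook)
    then have "r' = 0" using x assms by (auto simp: cells_hook)
    then show ?thesis using r' x by (simp add: tab_hook_0)
  qed
  then show "q \<in> {q. q permutes hook_column n j}" using q permutes_superset by blast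
next
  fix q assume "q \<in> {q. q permutes hook_column n j}"
  then have q: "q permutes hook_column n j" by simp
  have entry: "\<exists>r'. (r', 0) \<in> cells (hook n j) \<and> x = tab (hook n j) (r', 0)" if "x \<in> hook_column n j" for x
  proof (cases "x = 1")
    case True
    then show ?thesis using assms by (intro exI[of _ 0]) (auto simp: cells_hook tab_hook_0)
  next
    case False
    then show ?thesis using that assms
      by (intro exI[of _ "x - (n - j)"]) (auto simp: cells_hook tab_hook_pos hook_column_def)
  qed
  have "\<exists>r'. (r', c) \<in> cells (hook n j) \<and> q (tab (hook n j) (r, c)) = tab (hook n j) (r', c)"
    if rc: "(r, c) \<in> cells (hook n j)" for r c
  proof (cases "c = 0")
    case True
    have "tab (hook n j) (r, 0) \<in> hook_column n j"
      using rc True assms by (auto simp: cells_hook tab_hook_0 tab_hook_pos hook_column_def)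
    then show ?thesis using True entry permutes_in_image[OF q] by blast
  next
    case False
    then have r: "r = 0" "c < n - j" using rc assms by (auto simp: cells_hook)
    then have "q (c + 1) = c + 1" using False permutes_not_in[OF q, of "c + 1"] by (auto simp: hook_column_def)
    then show ?thesis using r rc by (intro exI[of _ 0]) (simp add: tab_hook_0)
  qed
  then show "q \<in> col_group (hook n j) n"
    using permutes_subset[OF q hook_column_subset[OF assms]] by (auto simp: col_group_def)
qed

text \<open>The quotient \<open>inv p' \<circ> p\<close> equals \<open>q' \<circ> inv q\<close>, so
  it moves only entries common to the first row and the first column. These share the corner entry 1
  alone.\<close>

lemma hook_decomposition_unique:
  assumes "j < n" "p permutes {1..n - j}" "q permutes hook_column n j"
    and "p' permutes {1..n - j}" "q' permutes hook_column n j" and eq: "p \<circ> q = p' \<circ> q'"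
  shows "p = p' \<and> q = q'"
proof -
  define s where "s = inv p' \<circ> p"
  have inv: "inv p' \<circ> p' = id" "q \<circ> inv q = id" "p' \<circ> inv p' = id" "inv q \<circ> q = id"
    using assms permutes_inv_o by blast+
  have "s \<circ> q = inv p' \<circ> p' \<circ> q'" by (simp add: s_def comp_assoc eq)
  then have sq: "s \<circ> q = q'" using inv by simp
  then have "q' \<circ> inv q = s \<circ> (q \<circ> inv q)" by (simp flip: comp_assoc)
  then have s: "s = q' \<circ> inv q" using inv by simp
  have s1: "s permutes {1..n - j}" unfolding s_def using assms by (simp add: permutes_compose permutes_inv)
  have s2: "s permutes hook_column n j" unfolding s using assms by (simp add: permutes_compose permutes_inv)
  have "s permutes {1}"
    using s1 by (rule permutes_superset) (auto intro!: permutes_not_in[OF s2] simp: hook_column_def)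
  then have "s = id" by simp
  then have "q = q'" using sq by simp
  moreover have "p = p' \<circ> s" using inv by (simp add: s_def flip: comp_assoc)
  ultimately show ?thesis using \<open>s = id\<close> by simp
qed

text \<open>By hypothesis \<open>\<pi>\<close> maps the column onto {n - j + 1..n} and one further
  value b. Let \<open>q\<close> copy \<open>\<pi>\<close> on the column, except that the preimage of
  b goes to the corner entry 1; then \<open>\<pi> \<circ> inv q\<close> fixes n - j + 1, ..., n and
  permutes the first row.\<close>

lemma hook_decomposition_exists:
  assumes "j < n" "\<pi> permutes {1..n}" "{n - j + 1..n} \<subseteq> \<pi> ` hook_column n j"
  obtains p q where "p permutes {1..n - j}" "q permutes hook_column n j" "\<pi> = p \<circ> q"
proof -
  let ?E = "hook_column n j" let ?D = "{n - j + 1..n}"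
  have inj: "inj \<pi>" using assms(2) by (rule permutes_inj)
  have "card (\<pi> ` ?E - ?D) = 1"
    using assms permutes_card_image[OF assms(2), of ?E] by (simp add: card_Diff_subset card_hook_column)
  then obtain b where b: "\<pi> ` ?E - ?D = {b}" by (auto simp: card_1_singleton_iff)
  define q where "q x = (if x \<in> ?E then if \<pi> x \<in> ?D then \<pi> x else 1 else x)" for x
  have "inj_on q ?E"
  proof (rule inj_onI)
    fix x y assume xy: "x \<in> ?E" "y \<in> ?E" "q x = q y"
    have 1: "1 \<notin> ?D" using assms(1) by auto
    have out: "\<pi> z = b" if "z \<in> ?E" "\<pi> z \<notin> ?D" for z using that b by blast
    have "q z = (if \<pi> z \<in> ?D then \<pi> z else 1)" if "z \<in> ?E" for z
      unfolding q_def using that by (rule if_P)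
    then have "(if \<pi> x \<in> ?D then \<pi> x else 1) = (if \<pi> y \<in> ?D then \<pi> y else 1)"
      using xy by metis
    then have "\<pi> x = \<pi> y" using 1 out xy(1,2) by metis
    then show "x = y" using inj by (simp add: inj_eq)
  qed
  moreover have "q x \<in> ?E" if "x \<in> ?E" for x
    using that unfolding q_def hook_column_def by simp
  then have "q ` ?E \<subseteq> ?E" by blast
  ultimately have "bij_betw q ?E ?E" by (simp add: bij_betw_def endo_inj_surj)
  then have q: "q permutes ?E" by (rule bij_imp_permutes) (simp add: q_def)
  define p where "p = \<pi> \<circ> inv q"
  have pn: "p permutes {1..n}"
    unfolding p_def using assms(2) permutes_subset[OF q hook_column_subset[OF assms(1)]]
    by (simp add: permutes_compose permutes_inv)
  have pD: "p x = x" if x: "x \<in> ?D" for x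
  proof -
    obtain y where y: "y \<in> ?E" "\<pi> y = x" using x assms(3) by auto
    then have "q y = x" using x by (simp add: q_def)
    then show ?thesis using y permutes_inverses(2)[OF q] by (auto simp: p_def)
  qed
  have "p permutes {1..n - j}"
  proof (rule permutes_superset[OF pn])
    fix x assume "x \<in> {1..n} - {1..n - j}"
    then have "x \<in> ?D" by auto
    then show "p x = x" by (rule pD)
  qed
  moreover have "\<pi> = p \<circ> q" using permutes_inv_o(2)[OF q] by (simp add: p_def comp_assoc)
  ultimately show thesis using that q by blast
qed

text \<open>Put D = {n - j + 1..n}. In s \<and> e_D only the terms e_b \<and> e_D with b \<le> n - j
  survive, and D with such a b added is the form of the image of the column under
  \<open>p \<circ> q\<close>. The decomposition being unique, the Young symmetrizer has at most one
  term at each \<open>\<pi>\<close>, with sign that of \<open>q\<close>.\<close>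

lemma young_sym_hook:
  assumes "j < n"
  shows "young_sym (hook n j) n =
    (hook_map n j (wedge_s n (fsingle {n - j + 1..n})) :: _ \<Rightarrow> 'a::field)"
proof
  fix \<pi>
  let ?E = "hook_column n j" let ?D = "{n - j + 1..n}"
  let ?R = "{p. p permutes {1..n - j}}" let ?C = "{q. q permutes ?E}"
  have fin: "finite ?R" "finite ?C" by (simp_all add: finite_permutations)
  have Y: "young_sym (hook n j) n \<pi> = (\<Sum>p\<in>?R. \<Sum>q\<in>?C. if p \<circ> q = \<pi> then of_int (sign q) else 0 :: 'a)"
    using assms by (simp add: young_sym_def row_group_hook col_group_hook)
  show "young_sym (hook n j) n \<pi> = (hook_map n j (wedge_s n (fsingle ?D)) \<pi> :: 'a)"
  proof (cases "\<exists>p q. p permutes {1..n - j} \<and> q permutes ?E \<and> \<pi> = p \<circ> q")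
    case True
    then obtain p q where p: "p permutes {1..n - j}" and q: "q permutes ?E" and \<pi>: "\<pi> = p \<circ> q" by blast
    have "young_sym (hook n j) n \<pi> =
        (\<Sum>p'\<in>?R. \<Sum>q'\<in>?C. if p' = p then if q' = q then of_int (sign q) else 0 else 0 :: 'a)"
      unfolding Y unfolding \<pi>
    proof (intro sum.cong refl)
      fix p' q' assume "p' \<in> ?R" "q' \<in> ?C"
      then have "p' \<circ> q' = p \<circ> q \<longleftrightarrow> p' = p \<and> q' = q"
        using hook_decomposition_unique[OF assms, of p' q' p q] p q by auto
      then show "(if p' \<circ> q' = p \<circ> q then of_int (sign q') else 0) =
          (if p' = p then if q' = q then of_int (sign q) else 0 else 0 :: 'a)"
        by auto
    qed
    also have "\<dots> = (\<Sum>p'\<in>?R. if p' = p then of_int (sign q) else 0)"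
      using fin q by (intro sum.cong) auto
    also have "\<dots> = of_int (sign q)" using fin p by simp
    finally have 1: "young_sym (hook n j) n \<pi> = (of_int (sign q) :: 'a)" .
    have p1: "p 1 \<in> {1..n - j}" using permutes_in_image[OF p, of 1] assms by simp
    have pD: "p x = x" if "x \<in> ?D" for x using that permutes_not_in[OF p] by simp
    have "p ` ?D = ?D" using pD by (metis image_cong image_ident)
    then have pE: "p ` ?E = insert (p 1) ?D" by (simp add: hook_column_def)
    have \<pi>E: "\<pi> ` ?E = insert (p 1) ?D"
      unfolding \<pi> image_comp[symmetric] permutes_image[OF q] by (rule pE)
    have perm: "\<pi> permutes {1..n}"
      unfolding \<pi> using permutes_subset[OF p, of "{1..n}"] permutes_subset[OF q hook_column_subset[OF assms]]
      by (simp add: permutes_compose)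
    \<comment> \<open>\<open>p\<close> fixes the lower column entries and keeps the corner entry
      below them, so it is monotone on the column.\<close>
    have "inv_sign p ?E = (1 :: 'a)"
    proof (rule inv_sign_mono_on)
      fix x y assume "x \<in> ?E" "y \<in> ?E" "x < y"
      then have "y \<in> ?D" "x = 1 \<or> x \<in> ?D" using assms by (auto simp: hook_column_def)
      then show "p x \<le> p y" using \<open>x < y\<close> p1 pD[of y] pD[of x] by auto
    qed
    then have 2: "inv_sign \<pi> ?E = (of_int (sign q) :: 'a)"
      using inv_sign_comp_inj[of ?E p q, where 'a='a] permutes_inj[OF p] permutes_inj_on[OF q]
      by (simp only: \<pi> permutes_image[OF q] inv_sign_permutes[OF finite_hook_column q] finite_hook_column mult_1_left)
    have "wedge_s n (fsingle ?D) (insert (p 1) ?D) =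
        (\<Sum>i\<in>insert (p 1) ?D. if i = p 1 then 1 else 0 :: 'a)"
    proof -
      have "pos_sign (p 1) (insert (p 1) ?D) = (1 :: 'a)"
        unfolding pos_sign_def using p1 by (intro prod.neutral) auto
      moreover have "insert (p 1) ?D - {i} = ?D \<longleftrightarrow> i = p 1" if "i \<in> insert (p 1) ?D" for i
      proof -
        have "p 1 \<notin> ?D" using p1 by simp
        then show ?thesis using that by blast
      qed
      moreover have "insert (p 1) ?D \<subseteq> {1..n}" using p1 assms by auto
      ultimately show ?thesis
        unfolding wedge_s_def fsingle_def by (simp only: if_True) (rule sum.cong, simp_all only: if_True if_False mult_1_right mult_zero_right split: if_split, simp)
    qed
    also have "\<dots> = 1" by simp
    finally show ?thesis using 1 2 perm \<pi>E by (simp add: hook_map_def)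
  next
    case False
    then have "young_sym (hook n j) n \<pi> = (0 :: 'a)"
      unfolding Y by (intro sum.neutral ballI) auto
    moreover have "wedge_s n (fsingle ?D) (\<pi> ` ?E) = (0 :: 'a)" if "\<pi> permutes {1..n}"
    proof -
      have "\<pi> ` ?E - {i} \<noteq> ?D" for i
        using hook_decomposition_exists[OF assms that] False by (metis Diff_subset)
      then show ?thesis by (simp add: wedge_s_def fsingle_def)
    qed
    ultimately show ?thesis by (simp add: hook_map_def)
  qed
qed

lemma hook_map_ext_act:
  fixes \<omega> :: "nat set \<Rightarrow> 'a::comm_ring_1"
  assumes \<sigma>: "\<sigma> permutes {1..n}"
  shows "hook_map n j (ext_act \<sigma> \<omega>) = (\<lambda>\<pi>. hook_map n j \<omega> (inv \<sigma> \<circ> \<pi>))"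
proof
  fix \<pi>
  have inv\<sigma>: "inv \<sigma> permutes {1..n}" using \<sigma> by (rule permutes_inv)
  show "hook_map n j (ext_act \<sigma> \<omega>) \<pi> = hook_map n j \<omega> (inv \<sigma> \<circ> \<pi>)"
  proof (cases "\<pi> permutes {1..n}")
    case True
    have "inv_sign (inv \<sigma> \<circ> \<pi>) (hook_column n j) =
        (inv_sign (inv \<sigma>) (\<pi> ` hook_column n j) * inv_sign \<pi> (hook_column n j) :: 'a)"
      using permutes_inj[OF inv\<sigma>] permutes_inj_on[OF True] by (intro inv_sign_comp_inj) auto
    then show ?thesis
      using True permutes_compose[OF True inv\<sigma>] by (simp add: hook_map_def ext_act_def image_comp)
  next
    case False
    have "\<not> (inv \<sigma> \<circ> \<pi>) permutes {1..n}"
    proof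
      assume "(inv \<sigma> \<circ> \<pi>) permutes {1..n}"
      then have "\<sigma> \<circ> (inv \<sigma> \<circ> \<pi>) permutes {1..n}" using \<sigma> by (rule permutes_compose)
      then show False using False permutes_inv_o[OF \<sigma>] by (simp flip: comp_assoc)
    qed
    then show ?thesis using False by (simp add: hook_map_def)
  qed
qed

text \<open>Each subset of size j + 1 is the image of the column under some permutation, so every
  coefficient of \<open>\<omega>\<close> is recorded up to sign.\<close>

lemma hook_map_eq_0:
  assumes "j < n" "\<omega> \<in> ext_space n {Suc j}" "hook_map n j \<omega> = (0 :: _ \<Rightarrow> 'a::field)"
  shows "\<omega> = 0"
proof
  fix I
  show "\<omega> I = 0 I"
  proof (cases "I \<in> ext_basis n {Suc j}")
    case True
    then obtain \<pi> where \<pi>: "\<pi> permutes {1..n}" "\<pi> ` hook_column n j = I"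
      using ex_permutes_image[of "{1..n}" "hook_column n j" I] assms(1) hook_column_subset[OF assms(1)]
      by (auto simp: ext_basis_def card_hook_column)
    have "hook_map n j \<omega> \<pi> = 0" using assms(3) by simp
    then show ?thesis using \<pi> by (simp add: hook_map_def)
  next
    case False
    then show ?thesis using assms(2) by (simp add: fsupp_def)
  qed
qed

text \<open>\<Lambda>^j is generated as a module by any one basis vector. The vector taken here
  belongs to the column without its corner, in accordance with
  \<open>young_sym_hook\<close>.\<close>

lemma ext_space_generated:
  assumes "j \<le> n"
  shows "(\<lambda>x. \<Sum>\<rho> | \<rho> permutes {1..n}. fsc (x \<rho>) (ext_act \<rho> (fsingle {n - j + 1..n}))) ` group_alg n
    = (ext_space n {j} :: (nat set \<Rightarrow> 'a::field) set)"
proof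
  let ?e = "fsingle {n - j + 1..n} :: nat set \<Rightarrow> 'a"
  let ?P = "{\<rho>. \<rho> permutes {1..n}}"
  define avg where "avg x = (\<Sum>\<rho>\<in>?P. fsc (x \<rho>) (ext_act \<rho> ?e))" for x
  have e: "?e \<in> ext_space n {j}"
    using assms by (auto simp: fsupp_def fsingle_def ext_basis_def)
  have "avg x \<in> ext_space n {j}" for x
    unfolding avg_def
    by (intro fsc.subspace_sum fsc.subspace_scale subspace_fsupp ext_act_in_ext_space[OF _ e]) simp
  then show "(\<lambda>x. \<Sum>\<rho>\<in>?P. fsc (x \<rho>) (ext_act \<rho> ?e)) ` group_alg n \<subseteq> ext_space n {j}"
    unfolding avg_def by blast
  have lin: "flinear avg"
    by (rule flinearI) (simp_all add: avg_def fun_eq_iff sum_fun_apply algebra_simps sum.distrib sum_distrib_left)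
  interpret avg: Vector_Spaces.linear fsc fsc avg by fact
  have ga: "group_alg n = (fsupp ?P :: ((nat \<Rightarrow> nat) \<Rightarrow> 'a) set)"
    by (auto simp: group_alg_def fsupp_def)
  have sub: "fsc.subspace (avg ` group_alg n)"
    unfolding ga by (intro avg.subspace_image subspace_fsupp)
  have single: "avg (fsingle \<rho>) = ext_act \<rho> ?e" if "\<rho> permutes {1..n}" for \<rho>
  proof -
    have "avg (fsingle \<rho>) = (\<Sum>\<rho>'\<in>?P. if \<rho>' = \<rho> then ext_act \<rho>' ?e else 0)"
      unfolding avg_def by (intro sum.cong) (auto simp: fsingle_def fun_eq_iff)
    then show ?thesis using that by simp
  qed
  have "fsingle A \<in> avg ` group_alg n" if A: "A \<in> ext_basis n {j}" for A
  proof -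
    obtain \<rho> where \<rho>: "\<rho> permutes {1..n}" "\<rho> ` {n - j + 1..n} = A"
      using ex_permutes_image[of "{1..n}" "{n - j + 1..n}" A] A assms by (auto simp: ext_basis_def)
    have "avg (fsingle \<rho>) \<in> avg ` group_alg n"
      using \<rho> by (intro imageI) (simp add: ga fsupp_def fsingle_def)
    then show ?thesis
      using ext_act_fsingle[OF \<rho>(1), of "{n - j + 1..n}", where 'a='a] \<rho> single[OF \<rho>(1)] sub
      by (auto intro: fsc.subspace_scale)
  qed
  then show "ext_space n {j} \<subseteq> (\<lambda>x. \<Sum>\<rho>\<in>?P. fsc (x \<rho>) (ext_act \<rho> ?e)) ` group_alg n"
    using fsupp_subset_subspaceI[OF finite_ext_basis sub] unfolding avg_def by blast
qed

text \<open>Both maps are equivariant, so the left multiples of the Young symmetrizer come from the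
  submodule generated by e_D with D = {n - j + 1..n}, which is all of \<Lambda>^j.\<close>

lemma specht_module_hook:
  assumes "j < n"
  shows "specht_module (hook n j) n =
    (hook_map n j ` wedge_s n ` ext_space n {j} :: ((nat \<Rightarrow> nat) \<Rightarrow> 'a::field) set)"
proof -
  let ?e = "fsingle {n - j + 1..n} :: nat set \<Rightarrow> 'a"
  let ?P = "{\<rho>. \<rho> permutes {1..n}}"
  interpret hook_map: Vector_Spaces.linear fsc fsc "hook_map n j :: _ \<Rightarrow> _ \<Rightarrow> 'a" by (rule flinear_hook_map)
  interpret wedge_s: Vector_Spaces.linear fsc fsc "wedge_s n :: _ \<Rightarrow> _ \<Rightarrow> 'a" by (rule flinear_wedge_s)
  have "ga_mult n x (young_sym (hook n j) n) =
      hook_map n j (wedge_s n (\<Sum>\<rho>\<in>?P. fsc (x \<rho>) (ext_act \<rho> ?e)))" for x :: "(nat \<Rightarrow> nat) \<Rightarrow> 'a"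
  proof -
    have "hook_map n j (wedge_s n (\<Sum>\<rho>\<in>?P. fsc (x \<rho>) (ext_act \<rho> ?e))) =
        (\<Sum>\<rho>\<in>?P. fsc (x \<rho>) (hook_map n j (wedge_s n (ext_act \<rho> ?e))))"
      by (simp only: wedge_s.sum hook_map.sum wedge_s.scale hook_map.scale)
    also have "\<dots> = (\<Sum>\<rho>\<in>?P. fsc (x \<rho>) (\<lambda>\<pi>. hook_map n j (wedge_s n ?e) (inv \<rho> \<circ> \<pi>)))"
      by (intro sum.cong) (simp_all add: wedge_s_ext_act hook_map_ext_act)
    finally show ?thesis
      by (simp add: ga_mult_def young_sym_hook[OF assms] sum_fun_apply fun_eq_iff)
  qed
  then have "specht_module (hook n j) n = hook_map n j ` wedge_s n `
      (\<lambda>x. \<Sum>\<rho>\<in>?P. fsc (x \<rho>) (ext_act \<rho> ?e)) ` group_alg n"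
    by (auto simp: specht_module_def image_def)
  then show ?thesis using ext_space_generated[of j n, where 'a='a] assms by simp
qed

section \<open>Characters\<close>

definition hook_trace :: "nat \<Rightarrow> nat \<Rightarrow> (nat \<Rightarrow> nat) \<Rightarrow> 'a::field" where
  "hook_trace n j \<sigma> = ftrace (wedge_s n ` ext_space n {j}) (ext_act \<sigma>)"

lemma subspace_wedge_s_image:
  "fsc.subspace (wedge_s n ` ext_space n D :: (nat set \<Rightarrow> 'a::field) set)"
proof -
  interpret wedge_s: Vector_Spaces.linear fsc fsc "wedge_s n :: _ \<Rightarrow> _ \<Rightarrow> 'a" by (rule flinear_wedge_s)
  show ?thesis by (intro wedge_s.subspace_image subspace_fsupp)
qed

lemma wedge_s_image_subset: "wedge_s n ` ext_space n D \<subseteq> ext_space n (Suc ` D)"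
  using wedge_s_in_ext_space by blast

lemma ext_act_wedge_s_image:
  assumes "\<sigma> permutes {1..n}" "x \<in> wedge_s n ` ext_space n D"
  shows "ext_act \<sigma> x \<in> wedge_s n ` ext_space n D"
proof -
  obtain \<omega> where \<omega>: "\<omega> \<in> ext_space n D" "x = wedge_s n \<omega>" using assms(2) by blast
  then have "ext_act \<sigma> x = wedge_s n (ext_act \<sigma> \<omega>)" by (simp add: wedge_s_ext_act[OF assms(1)])
  then show ?thesis using ext_act_in_ext_space[OF assms(1) \<omega>(1)] by (rule image_eqI)
qed

lemma specht_char_hook:
  assumes \<sigma>: "\<sigma> permutes {1..n}"
  shows "specht_char n (hook n j) \<sigma> = (hook_trace n j \<sigma> :: 'a::field)"
proof (cases "j < n")
  case True
  let ?U = "wedge_s n ` ext_space n {j} :: (nat set \<Rightarrow> 'a) set"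
  have U: "?U \<subseteq> ext_space n {Suc j}" using wedge_s_image_subset[of n "{j}"] by simp
  have tr: "flinear (\<lambda>x \<pi>. x (inv \<sigma> \<circ> \<pi>) :: 'a)" by (rule flinearI) (auto simp: fun_eq_iff)
  have "ftrace (hook_map n j ` ?U) (\<lambda>x \<pi>. x (inv \<sigma> \<circ> \<pi>)) = ftrace ?U (ext_act \<sigma>)"
    using U hook_map_eq_0[OF True]
    by (intro ftrace_isomorphism[OF subspace_wedge_s_image U finite_ext_basis flinear_hook_map flinear_ext_act tr]
        ext_act_wedge_s_image[OF \<sigma>] hook_map_ext_act[OF \<sigma>]) auto
  then show ?thesis
    using True by (simp add: specht_char_def is_partition_hook specht_module_hook hook_trace_def)
next
  case False
  \<comment> \<open>There are no subsets of size j + 1 > n, so s \<and> \<Lambda>^j is 0 and its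
    trace agrees with the default value of \<open>specht_char\<close>.\<close>
  have "I \<notin> ext_basis n {Suc j}" for I
    using False card_mono[of "{1..n}" I] by (auto simp: ext_basis_def)
  then have "ext_space n {Suc j} = {0 :: nat set \<Rightarrow> 'a}" by (auto simp: fsupp_def)
  then have "wedge_s n ` ext_space n {j} \<subseteq> {0 :: nat set \<Rightarrow> 'a}"
    using wedge_s_image_subset[of n "{j}", where 'a='a] by simp
  moreover have "0 \<in> (wedge_s n ` ext_space n {j} :: (nat set \<Rightarrow> 'a) set)"
    using fsc.subspace_0[OF subspace_wedge_s_image] .
  ultimately have "wedge_s n ` ext_space n {j} = {0 :: nat set \<Rightarrow> 'a}" by blast
  then show ?thesis
    using False by (simp add: specht_char_def is_partition_hook hook_trace_def ftrace_zero)
qed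

lemma ftrace_ext_space_wedge_s:
  assumes \<sigma>: "\<sigma> permutes {1..n}"
  shows "ftrace (ext_space n {j}) (ext_act \<sigma>) =
    (ftrace {\<omega> \<in> ext_space n {j}. wedge_s n \<omega> = 0} (ext_act \<sigma>) + hook_trace n j \<sigma> :: 'a::field)"
  unfolding hook_trace_def
  by (rule ftrace_rank_nullity[where M = "ext_basis n {j}"])
    (simp_all add: subspace_fsupp flinear_wedge_s flinear_ext_act ext_act_in_ext_space[OF \<sigma>, simplified]
      wedge_s_ext_act[OF \<sigma>])

text \<open>The kernel of s on \<Lambda>^(j+1) is s \<and> \<Lambda>^j by exactness, and the image
  is s \<and> \<Lambda>^(j+1).\<close>

lemma ftrace_ext_space_Suc:
  assumes "1 \<le> n" "\<sigma> permutes {1..n}"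
  shows "ftrace (ext_space n {Suc j}) (ext_act \<sigma>) =
    (hook_trace n j \<sigma> + hook_trace n (Suc j) \<sigma> :: 'a::field_char_0)"
  unfolding ftrace_ext_space_wedge_s[OF assms(2)] wedge_s_kernel_Suc[OF assms(1)]
  by (simp add: hook_trace_def)

lemma ftrace_ext_space_0:
  assumes "1 \<le> n" "\<sigma> permutes {1..n}"
  shows "ftrace (ext_space n {0}) (ext_act \<sigma>) = (hook_trace n 0 \<sigma> :: 'a::field)"
  unfolding ftrace_ext_space_wedge_s[OF assms(2)] wedge_s_kernel_0[OF assms(1)]
  by (simp add: ftrace_zero)

section \<open>Splitting traces by exterior degree\<close>

definition degree_part :: "nat \<Rightarrow> (nat set \<Rightarrow> 'a::zero) \<Rightarrow> nat set \<Rightarrow> 'a" where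
  "degree_part j \<omega> = (\<lambda>I. if card I = j then \<omega> I else 0)"

lemma flinear_degree_part: "flinear (degree_part j)"
  by (rule flinearI) (auto simp: degree_part_def fun_eq_iff)

lemma degree_part_ext_act:
  assumes "\<sigma> permutes {1..n}"
  shows "degree_part j (ext_act \<sigma> \<omega>) = ext_act \<sigma> (degree_part j \<omega>)"
  using permutes_card_image[OF permutes_inv[OF assms]]
  by (auto simp: degree_part_def ext_act_def fun_eq_iff)

lemma degree_part_wedge_s: "degree_part (Suc j) (wedge_s n \<omega>) = wedge_s n (degree_part j \<omega>)"
proof
  fix I
  show "degree_part (Suc j) (wedge_s n \<omega>) I = wedge_s n (degree_part j \<omega>) I"
  proof (cases "I \<subseteq> {1..n}")
    case True
    then have "finite I" using finite_subset by blast
    then have "card (I - {i}) = j \<longleftrightarrow> card I = Suc j" if "i \<in> I" for i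
      using that card.remove[of I i] by auto
    then show ?thesis using True by (auto simp: degree_part_def wedge_s_def intro!: sum.cong sum.neutral[symmetric])
  qed (simp add: degree_part_def wedge_s_def)
qed

lemma degree_part_insert:
  fixes \<omega> :: "nat set \<Rightarrow> 'a::field"
  assumes "\<omega> \<in> ext_space n (insert j D)"
  shows "degree_part j \<omega> \<in> ext_space n {j}" "\<omega> - degree_part j \<omega> \<in> ext_space n D"
  using assms by (auto simp: fsupp_def degree_part_def ext_basis_def)

lemma degree_part_eq_0:
  assumes "\<omega> \<in> ext_space n D" "j \<notin> D"
  shows "degree_part j \<omega> = 0"
  using assms by (auto simp: fsupp_def degree_part_def ext_basis_def fun_eq_iff)

lemma degree_part_self: "\<omega> \<in> ext_space n {j} \<Longrightarrow> degree_part j \<omega> = \<omega>"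
  by (auto simp: fsupp_def degree_part_def ext_basis_def fun_eq_iff)

lemma ext_space_mono: "D \<subseteq> D' \<Longrightarrow> ext_space n D \<subseteq> ext_space n D'"
  by (auto simp: fsupp_def ext_basis_def)

text \<open>Projection to degree j commutes with the action, so rank-nullity detaches one degree at
  a time.\<close>

lemma ftrace_ext_space:
  assumes \<sigma>: "\<sigma> permutes {1..n}" and "finite D"
  shows "ftrace (ext_space n D) (ext_act \<sigma>) = (\<Sum>j\<in>D. ftrace (ext_space n {j}) (ext_act \<sigma>) :: 'a::field)"
  using assms(2)
proof (induction D rule: finite_induct)
  case empty
  have "ext_space n {} = {0 :: nat set \<Rightarrow> 'a}" by (auto simp: fsupp_def ext_basis_def)
  then show ?case by (simp add: ftrace_zero)
next
  case (insert j D)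
  let ?V = "ext_space n (insert j D) :: (nat set \<Rightarrow> 'a) set"
  have "{\<omega> \<in> ?V. degree_part j \<omega> = 0} = ext_space n D"
  proof (intro equalityI subsetI)
    fix \<omega> assume "\<omega> \<in> {\<omega> \<in> ?V. degree_part j \<omega> = 0}"
    then show "\<omega> \<in> ext_space n D" using degree_part_insert(2)[of \<omega> n j D] by simp
  next
    fix \<omega> :: "nat set \<Rightarrow> 'a" assume "\<omega> \<in> ext_space n D"
    then show "\<omega> \<in> {\<omega> \<in> ?V. degree_part j \<omega> = 0}"
      using degree_part_eq_0[OF _ insert.hyps(2)] ext_space_mono[of D "insert j D" n, where 'a='a] by auto
  qed
  moreover have "degree_part j ` ?V = ext_space n {j}"
  proof (intro equalityI subsetI)
    fix \<omega> :: "nat set \<Rightarrow> 'a" assume "\<omega> \<in> ext_space n {j}"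
    then show "\<omega> \<in> degree_part j ` ?V"
      using degree_part_self[of \<omega> n j] ext_space_mono[of "{j}" "insert j D" n, where 'a='a]
      by (intro image_eqI[of _ _ \<omega>]) auto
  qed (use degree_part_insert(1) in blast)
  moreover have "ftrace ?V (ext_act \<sigma>) =
      ftrace {\<omega> \<in> ?V. degree_part j \<omega> = 0} (ext_act \<sigma>) + ftrace (degree_part j ` ?V) (ext_act \<sigma>)"
    by (rule ftrace_rank_nullity[where M = "ext_basis n (insert j D)"])
      (simp_all add: subspace_fsupp flinear_degree_part flinear_ext_act
        ext_act_in_ext_space[OF \<sigma>, simplified] degree_part_ext_act[OF \<sigma>])
  ultimately have "ftrace ?V (ext_act \<sigma>) = ftrace (ext_space n D) (ext_act \<sigma>) + ftrace (ext_space n {j}) (ext_act \<sigma>)"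
    by simp
  then show ?case using insert by simp
qed

text \<open>Degrees are detached by projection again, to degree j + 1 now, because s raises the
  degree by one.\<close>

lemma ftrace_wedge_s_image:
  assumes \<sigma>: "\<sigma> permutes {1..n}" and "finite D"
  shows "ftrace (wedge_s n ` ext_space n D) (ext_act \<sigma>) = (\<Sum>j\<in>D. hook_trace n j \<sigma> :: 'a::field)"
  using assms(2)
proof (induction D rule: finite_induct)
  case empty
  have "ext_space n {} = {0 :: nat set \<Rightarrow> 'a}" by (auto simp: fsupp_def ext_basis_def)
  then show ?case by (simp only: image_insert image_empty wedge_s_zero ftrace_zero sum.empty)
next
  case (insert j D)
  interpret wedge_s: Vector_Spaces.linear fsc fsc "wedge_s n :: _ \<Rightarrow> _ \<Rightarrow> 'a" by (rule flinear_wedge_s)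
  let ?V = "wedge_s n ` ext_space n (insert j D) :: (nat set \<Rightarrow> 'a) set"
  have "{x \<in> ?V. degree_part (Suc j) x = 0} = wedge_s n ` ext_space n D"
  proof (intro equalityI subsetI)
    fix x assume "x \<in> {x \<in> ?V. degree_part (Suc j) x = 0}"
    then obtain \<omega> where \<omega>: "\<omega> \<in> ext_space n (insert j D)" "x = wedge_s n \<omega>" "wedge_s n (degree_part j \<omega>) = 0"
      by (auto simp: degree_part_wedge_s)
    then have "x = wedge_s n (\<omega> - degree_part j \<omega>)" by (simp only: wedge_s.diff diff_zero)
    then show "x \<in> wedge_s n ` ext_space n D" using degree_part_insert(2)[OF \<omega>(1)] by (rule image_eqI)
  next
    fix x :: "nat set \<Rightarrow> 'a" assume "x \<in> wedge_s n ` ext_space n D"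
    then obtain \<omega> where \<omega>: "\<omega> \<in> ext_space n D" "x = wedge_s n \<omega>" by blast
    have "degree_part (Suc j) x = 0"
      by (simp only: \<omega>(2) degree_part_wedge_s degree_part_eq_0[OF \<omega>(1) insert.hyps(2)] wedge_s_zero)
    moreover have "\<omega> \<in> ext_space n (insert j D)" using \<omega>(1) ext_space_mono[of D "insert j D" n] by blast
    ultimately show "x \<in> {x \<in> ?V. degree_part (Suc j) x = 0}" using \<omega>(2) by blast
  qed
  moreover have "degree_part (Suc j) ` ?V = wedge_s n ` degree_part j ` ext_space n (insert j D)"
    by (simp only: image_image degree_part_wedge_s)
  moreover have "degree_part j ` ext_space n (insert j D) = (ext_space n {j} :: (nat set \<Rightarrow> 'a) set)"
  proof (intro equalityI subsetI)
    fix \<omega> :: "nat set \<Rightarrow> 'a" assume "\<omega> \<in> ext_space n {j}"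
    then show "\<omega> \<in> degree_part j ` ext_space n (insert j D)"
      using degree_part_self[of \<omega> n j] ext_space_mono[of "{j}" "insert j D" n, where 'a='a]
      by (intro image_eqI[of _ _ \<omega>]) auto
  qed (use degree_part_insert(1) in blast)
  moreover have "ftrace ?V (ext_act \<sigma>) = ftrace {x \<in> ?V. degree_part (Suc j) x = 0} (ext_act \<sigma>) +
      ftrace (degree_part (Suc j) ` ?V) (ext_act \<sigma>)"
    by (rule ftrace_rank_nullity[where M = "ext_basis n (Suc ` insert j D)"])
      (simp_all only: subspace_wedge_s_image wedge_s_image_subset finite_ext_basis flinear_degree_part
        flinear_ext_act ext_act_wedge_s_image[OF \<sigma>] degree_part_ext_act[OF \<sigma>])
  ultimately have "ftrace ?V (ext_act \<sigma>) = ftrace (wedge_s n ` ext_space n D) (ext_act \<sigma>) + hook_trace n j \<sigma>"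
    by (simp only: hook_trace_def)
  then show ?case using insert by simp
qed

lemma ext_act_id_fun: "ext_act id = (\<lambda>\<omega>. \<omega>)"
  by (simp add: fun_eq_iff ext_act_id)

lemma card_ext_basis: "card (ext_basis n {j}) = n choose j"
  using n_subsets[of "{1..n}" j] by (simp add: ext_basis_def)

text \<open>At the identity, \<open>ftrace_ext_space_Suc\<close> turns into Pascal's rule for
  binomial coefficients.\<close>

lemma hook_trace_id:
  assumes "1 \<le> n"
  shows "hook_trace n j id = (of_nat ((n - 1) choose j) :: 'a::field_char_0)"
proof (induction j)
  case 0
  have "hook_trace n 0 id = (1 :: 'a)"
    using ftrace_ext_space_0[OF assms permutes_id, where 'a='a]
    by (simp add: ext_act_id_fun ftrace_fsupp_id card_ext_basis)
  then show ?case by (simp add: id_def)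
next
  case (Suc j)
  obtain m where m: "n = Suc m" using assms by (cases n) auto
  have "(of_nat (n choose Suc j) :: 'a) = hook_trace n j id + hook_trace n (Suc j) id"
    using ftrace_ext_space_Suc[OF assms permutes_id, of j, where 'a='a]
    by (simp add: ext_act_id_fun ftrace_fsupp_id card_ext_basis)
  then show ?case using Suc m by (simp add: id_def)
qed

section \<open>Central polynomials and identities as kernels, with their characters\<close>

lemma CPgr_eq_kernel:
  assumes "1 \<le> n"
  shows "CPgr (grassmann_trivial k :: (nat set, 'a::field_char_0) superalg) n =
    {f \<in> Pgr n. ext_map n (Suc ` (*) 2 ` {..<k}) f = 0}"
proof -
  have "I \<in> ext_basis n (Suc ` (*) 2 ` {..<k}) \<longleftrightarrow> I \<subseteq> {1..n} \<and> odd (card I) \<and> card I < 2 * k" for I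
    by (auto simp: ext_basis_def elim!: oddE)
  then show ?thesis unfolding CPgr_grassmann[OF assms] ext_map_eq_0_iff by blast
qed

text \<open>By \<open>ext_map_Suc\<close> vanishing in an even degree forces vanishing in the next
  odd one. Hence the conditions reduce to the even degrees 0, 2, ..., 2k, in which
  \<open>ext_map\<close> is onto.\<close>

lemma IdPgr_eq_kernel:
  assumes "1 \<le> n"
  shows "IdPgr (grassmann_trivial k :: (nat set, 'a::field) superalg) n =
    {f \<in> Pgr n. ext_map n ((*) 2 ` {..k}) f = 0}"
proof -
  let ?D = "(*) 2 ` {..k}"
  have D: "\<And>j. j \<in> ?D \<Longrightarrow> even j" by auto
  have "(\<forall>I. I \<subseteq> {1..n} \<longrightarrow> card I \<le> 2 * k \<longrightarrow> sgn_form n f I = 0) \<longleftrightarrow> ext_map n ?D f = 0"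
    for f :: "(nat \<Rightarrow> nat) \<times> nat set \<Rightarrow> 'a"
  proof
    assume "\<forall>I. I \<subseteq> {1..n} \<longrightarrow> card I \<le> 2 * k \<longrightarrow> sgn_form n f I = 0"
    then show "ext_map n ?D f = 0" unfolding ext_map_eq_0_iff by (auto simp: ext_basis_def)
  next
    assume 0: "ext_map n ?D f = 0"
    have "ext_map n (Suc ` ?D) f = wedge_s n (ext_map n ?D f)" by (rule ext_map_Suc[OF D])
    then have 1: "ext_map n (Suc ` ?D) f = 0" by (simp only: 0 wedge_s_zero)
    show "\<forall>I. I \<subseteq> {1..n} \<longrightarrow> card I \<le> 2 * k \<longrightarrow> sgn_form n f I = 0"
    proof (intro allI impI)
      fix I assume I: "I \<subseteq> {1..n}" "card I \<le> 2 * k"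
      then have "I \<in> ext_basis n ?D \<or> I \<in> ext_basis n (Suc ` ?D)"
        by (cases "even (card I)") (auto simp: ext_basis_def elim!: oddE evenE)
      then show "sgn_form n f I = 0" using 0 1 unfolding ext_map_eq_0_iff by blast
    qed
  qed
  then show ?thesis unfolding IdPgr_grassmann[OF assms] by auto
qed

lemma ftrace_Pgr:
  assumes \<sigma>: "\<sigma> permutes {1..n}"
  shows "ftrace (Pgr n) (wr_act n (N, \<sigma>)) = ftrace {f \<in> Pgr n. ext_map n D f = 0} (wr_act n (N, \<sigma>))
    + (ftrace (ext_map n D ` Pgr n) (ext_act \<sigma>) :: 'a::field)"
  unfolding Pgr_eq_fsupp
  by (rule ftrace_rank_nullity[where M = "gr_monos n"])
    (simp_all add: subspace_fsupp flinear_ext_map flinear_wr_act flinear_ext_act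
      wr_act_in_Pgr[unfolded Pgr_eq_fsupp] ext_map_wr_act[OF \<sigma>])

text \<open>The odd-degree map factors through the even degrees, which are reached completely; its
  image is thus s times the even part, and rank-nullity gives the character.\<close>

lemma chi_grz_grassmann:
  assumes "1 \<le> n" and \<sigma>: "\<sigma> permutes {1..n}"
  shows "chi_grz (grassmann_trivial k :: (nat set, 'a::field_char_0) superalg) n (N, \<sigma>) =
    (\<Sum>i<k. hook_trace n (2 * i) \<sigma>)"
proof -
  let ?D = "(*) 2 ` {..<k}"
  have "ext_map n (Suc ` ?D) ` Pgr n = (\<lambda>f. wedge_s n (ext_map n ?D f)) ` (Pgr n :: (_ \<Rightarrow> 'a) set)"
    by (intro image_cong refl ext_map_Suc) auto
  also have "\<dots> = wedge_s n ` ext_map n ?D ` Pgr n" by (rule image_image[symmetric])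
  also have "ext_map n ?D ` Pgr n = (ext_space n ?D :: (nat set \<Rightarrow> 'a) set)"
    by (intro ext_map_Pgr) auto
  finally have "chi_grz (grassmann_trivial k :: (nat set, 'a) superalg) n (N, \<sigma>) =
      ftrace (wedge_s n ` ext_space n ?D) (ext_act \<sigma>)"
    by (simp only: chi_grz_def CPgr_eq_kernel[OF assms(1)] ftrace_Pgr[OF \<sigma>, of N "Suc ` ?D"]
        add_diff_cancel_left')
  also have "\<dots> = (\<Sum>j\<in>?D. hook_trace n j \<sigma>)"
    by (rule ftrace_wedge_s_image[OF \<sigma>]) simp
  finally show ?thesis by (simp add: sum.reindex inj_on_def)
qed

lemma chi_Delta_grassmann:
  assumes "1 \<le> n" and \<sigma>: "\<sigma> permutes {1..n}"
  shows "chi_Delta (grassmann_trivial k :: (nat set, 'a::field_char_0) superalg) n (N, \<sigma>) =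
    hook_trace n (2 * k) \<sigma> + (\<Sum>i<k. hook_trace n (2 * i + 1) \<sigma>)"
proof -
  let ?D = "(*) 2 ` {..k}" let ?G = "grassmann_trivial k :: (nat set, 'a) superalg"
  \<comment> \<open>For i > 0 degree 2i contributes the hook traces 2i - 1 and 2i, whereas degree 0
    has only the trace 0. This is why the odd sum, shifted to 2i + 1, has one term fewer.\<close>
  have sum: "(\<Sum>i\<le>k. ftrace (ext_space n {2 * i}) (ext_act \<sigma>)) =
      (\<Sum>i\<le>k. hook_trace n (2 * i) \<sigma>) + (\<Sum>i<k. hook_trace n (2 * i + 1) \<sigma> :: 'a)"
  proof (induction k)
    case 0
    then show ?case by (simp add: ftrace_ext_space_0[OF assms])
  next
    case (Suc k)
    then show ?case
      using ftrace_ext_space_Suc[OF assms, of "2 * k + 1", where 'a='a] by (simp add: algebra_simps)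
  qed
  have "ext_space n ?D = ext_map n ?D ` (Pgr n :: (_ \<Rightarrow> 'a) set)"
    by (intro ext_map_Pgr[symmetric]) auto
  then have "ftrace (Pgr n) (wr_act n (N, \<sigma>)) =
      ftrace (IdPgr ?G n) (wr_act n (N, \<sigma>)) + ftrace (ext_space n ?D) (ext_act \<sigma>)"
    by (simp only: IdPgr_eq_kernel[OF assms(1)] ftrace_Pgr[OF \<sigma>, of N ?D])
  then have "ftrace (Pgr n) (wr_act n (N, \<sigma>)) - ftrace (IdPgr ?G n) (wr_act n (N, \<sigma>)) =
      ftrace (ext_space n ?D) (ext_act \<sigma>)"
    by (simp only: add_diff_cancel_left')
  also have "\<dots> = (\<Sum>j\<in>?D. ftrace (ext_space n {j}) (ext_act \<sigma>))"
    by (rule ftrace_ext_space[OF \<sigma>]) simp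
  also have "\<dots> = (\<Sum>i\<le>k. ftrace (ext_space n {2 * i}) (ext_act \<sigma>))"
    by (simp add: sum.reindex inj_on_def)
  finally have "ftrace (Pgr n) (wr_act n (N, \<sigma>)) - ftrace (IdPgr ?G n) (wr_act n (N, \<sigma>)) =
      (\<Sum>i<k. hook_trace n (2 * i) \<sigma>) + hook_trace n (2 * k) \<sigma> + (\<Sum>i<k. hook_trace n (2 * i + 1) \<sigma>)"
    unfolding sum by (simp flip: lessThan_Suc_atMost)
  moreover have "chi_Delta ?G n (N, \<sigma>) =
      (ftrace (Pgr n) (wr_act n (N, \<sigma>)) - ftrace (IdPgr ?G n) (wr_act n (N, \<sigma>))) - chi_grz ?G n (N, \<sigma>)"
    by (simp add: chi_Delta_def chi_grz_def)
  ultimately show ?thesis by (simp add: chi_grz_grassmann[OF assms])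
qed

text \<open>\<open>wr_act\<close> cuts off everything outside the monomials of degree n, so at the
  neutral element it agrees with the identity on \<open>Pgr n\<close>, which is enough for the
  trace.\<close>

lemma of_nat_fdim_wr_act:
  fixes U :: "((nat \<Rightarrow> nat) \<times> nat set \<Rightarrow> 'a::field) set"
  assumes "fsc.subspace U" "U \<subseteq> Pgr n"
  shows "of_nat (fdim U) = ftrace U (wr_act n ({}, id))"
  unfolding of_nat_fdim[OF assms(1)] using assms(1)
  by (intro ftrace_cong wr_act_id[symmetric] subsetD[OF assms(2)])

lemma subspace_ext_map_kernel:
  "fsc.subspace {f \<in> Pgr n. ext_map n D f = (0 :: nat set \<Rightarrow> 'a::field)}"
proof -
  interpret ext_map: Vector_Spaces.linear fsc fsc "ext_map n D :: _ \<Rightarrow> nat set \<Rightarrow> 'a" by (rule flinear_ext_map)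
  show ?thesis
    using subspace_fsupp[of "gr_monos n", where 'a='a]
    by (auto simp: Pgr_eq_fsupp fsc.subspace_def ext_map.add ext_map.scale ext_map.zero)
qed

text \<open>Characteristic zero lifts the equation of traces to natural numbers in the additive form
  \<open>fdim U = fdim V + m\<close>, so the subtraction is not truncated.\<close>

lemma fdim_diff_eqI:
  fixes U V :: "((nat \<Rightarrow> nat) \<times> nat set \<Rightarrow> 'a::field_char_0) set"
  assumes "fsc.subspace U" "U \<subseteq> Pgr n" "fsc.subspace V" "V \<subseteq> Pgr n"
    and "ftrace U (wr_act n ({}, id)) - ftrace V (wr_act n ({}, id)) = of_nat m"
  shows "fdim U - fdim V = m"
proof -
  have "(of_nat (fdim U) :: 'a) = of_nat (fdim V + m)"
    using assms of_nat_fdim_wr_act[of U n] of_nat_fdim_wr_act[of V n] by (simp add: algebra_simps)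
  then have "fdim U = fdim V + m" by (simp only: of_nat_eq_iff)
  then show ?thesis by simp
qed

theorem theorem4p4:
  fixes k n :: nat
  assumes "1 \<le> k" and "1 \<le> n"
  defines "G \<equiv> (grassmann_trivial k :: (nat set, 'a::field_char_0) superalg)"
  shows "cgrz G n = (\<Sum>i<k. (n - 1) choose (2 * i))
    \<and> deltagr G n = (n choose (2 * k)) + (\<Sum>i<k - 1. (n - 1) choose (2 * i + 1))
    \<and> (\<forall>g\<in>wreath n. chi_grz G n g = (\<Sum>i<k. wr_char_even n (hook n (2 * i)) g))
    \<and> (\<forall>g\<in>wreath n. chi_Delta G n g =
           wr_char_even n (hook n (2 * k)) g + (\<Sum>i<k. wr_char_even n (hook n (2 * i + 1)) g))"
proof (intro conjI ballI)
  have P: "fsc.subspace (Pgr n :: (_ \<Rightarrow> 'a) set)" unfolding Pgr_eq_fsupp by (rule subspace_fsupp)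
  have C: "fsc.subspace (CPgr G n)"
    unfolding G_def CPgr_eq_kernel[OF assms(2)] by (rule subspace_ext_map_kernel)
  have Id: "fsc.subspace (IdPgr G n)"
    unfolding G_def IdPgr_eq_kernel[OF assms(2)] by (rule subspace_ext_map_kernel)
  have sub: "CPgr G n \<subseteq> Pgr n" "IdPgr G n \<subseteq> Pgr n" by (auto simp: CPgr_def IdPgr_def)
  have "chi_grz G n ({}, id) = of_nat (\<Sum>i<k. (n - 1) choose (2 * i))"
    unfolding G_def chi_grz_grassmann[OF assms(2) permutes_id] by (simp add: hook_trace_id[OF assms(2)])
  then show "cgrz G n = (\<Sum>i<k. (n - 1) choose (2 * i))"
    unfolding cgrz_def chi_grz_def by (rule fdim_diff_eqI[OF P subset_refl C sub(1)])
  obtain l m where l: "k = Suc l" and m: "n = Suc m" using assms by (cases k; cases n) auto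
  \<comment> \<open>The last summand, n - 1 over 2k - 1, combines with n - 1 over 2k to n over 2k by
    Pascal's rule, which shortens the sum to \<open>k - 1\<close> terms.\<close>
  have "((n - 1) choose (2 * k)) + (\<Sum>i<k. (n - 1) choose (2 * i + 1)) =
      (n choose (2 * k)) + (\<Sum>i<k - 1. (n - 1) choose (2 * i + 1))"
    by (simp add: l m)
  moreover have "chi_Delta G n ({}, id) =
      of_nat (((n - 1) choose (2 * k)) + (\<Sum>i<k. (n - 1) choose (2 * i + 1)))"
    unfolding G_def chi_Delta_grassmann[OF assms(2) permutes_id] by (simp add: hook_trace_id[OF assms(2)])
  ultimately have "chi_Delta G n ({}, id) =
      of_nat ((n choose (2 * k)) + (\<Sum>i<k - 1. (n - 1) choose (2 * i + 1)))"
    by metis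
  then show "deltagr G n = (n choose (2 * k)) + (\<Sum>i<k - 1. (n - 1) choose (2 * i + 1))"
    unfolding deltagr_def chi_Delta_def by (rule fdim_diff_eqI[OF C sub(1) Id sub(2)])
next
  fix g assume g: "g \<in> wreath n"
  obtain N \<sigma> where [simp]: "g = (N, \<sigma>)" by (cases g)
  have \<sigma>: "\<sigma> permutes {1..n}" using g by (simp add: wreath_def)
  show "chi_grz G n g = (\<Sum>i<k. wr_char_even n (hook n (2 * i)) g)"
    by (simp add: G_def chi_grz_grassmann[OF assms(2) \<sigma>] wr_char_even_def specht_char_hook[OF \<sigma>])
  show "chi_Delta G n g =
      wr_char_even n (hook n (2 * k)) g + (\<Sum>i<k. wr_char_even n (hook n (2 * i + 1)) g)"
    by (simp add: G_def chi_Delta_grassmann[OF assms(2) \<sigma>] wr_char_even_def specht_char_hook[OF \<sigma>])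
qed

end
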